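(* Let $\psi:[0,\infty)\to[0,\infty)$ be a continuous, increasing function satisfying $$\int_0^\infty\frac{\psi(x)}{1+x^2}\,dx=\infty.$$ Then for any closed set $\Lambda\subset\mathbb{R}$ of positive Lebesgue measure, $\Phi_\Lambda(\mathbb{R})$ is dense in $(C_\psi(\mathbb{R}),\|\cdot\|_\psi)$.
   Context: "Increasing" means $x\le y\Rightarrow\psi(x)\le\psi(y)$. $C_\psi(\mathbb{R})$ is the space of continuous functions $f:\mathbb{R}\to\mathbb{C}$ with $\lim_{|x|\to\infty} f(x)/e^{\psi(|x|)}=0$, with norm $\|f\|_\psi=\sup_{x\in\mathbb{R}}|f(x)|/e^{\psi(|x|)}$. For $\Lambda\subset\mathbb{R}$, $\Phi_\Lambda(\mathbb{R})$ is the complex linear span of $\{e_\lambda:\lambda\in\Lambda\}$, where $e_\lambda(x)=e^{-i\lambda x}$. *)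

theory Defs
  imports "HOL-Analysis.Analysis" "HOL-Library.Function_Algebras"
begin

definition C_weighted :: "(real \<Rightarrow> real) \<Rightarrow> (real \<Rightarrow> complex) set" where
  "C_weighted \<psi> = {f. continuous_on UNIV f \<and>
     ((\<lambda>x. f x / complex_of_real (exp (\<psi> \<bar>x\<bar>))) \<longlongrightarrow> 0) at_infinity}"

definition weighted_norm :: "(real \<Rightarrow> real) \<Rightarrow> (real \<Rightarrow> complex) \<Rightarrow> real" where
  "weighted_norm \<psi> f = (SUP x. cmod (f x) / exp (\<psi> \<bar>x\<bar>))"

text \<open>The real supremum in \<^const>\<open>weighted_norm\<close> is unspecified for unbounded sets, whereas
  \<^locale>\<open>Metric_space\<close> wants a distance that is nonnegative and symmetric even outside
  the carrier. Hence the case distinction; on \<^const>\<open>C_weighted\<close> this is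
  the metric induced by the norm.\<close>

definition weighted_dist ::
    "(real \<Rightarrow> real) \<Rightarrow> (real \<Rightarrow> complex) \<Rightarrow> (real \<Rightarrow> complex) \<Rightarrow> real" where
  "weighted_dist \<psi> f g =
     (if f \<in> C_weighted \<psi> \<and> g \<in> C_weighted \<psi> then weighted_norm \<psi> (f - g) else 0)"

definition C_weighted_topology :: "(real \<Rightarrow> real) \<Rightarrow> (real \<Rightarrow> complex) topology" where
  "C_weighted_topology \<psi> = Metric_space.mtopology (C_weighted \<psi>) (weighted_dist \<psi>)"

definition expo :: "real \<Rightarrow> real \<Rightarrow> complex" where
  "expo l x = exp (- \<i> * complex_of_real l * complex_of_real x)"

definition cfun_scale :: "complex \<Rightarrow> (real \<Rightarrow> complex) \<Rightarrow> real \<Rightarrow> complex" where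
  "cfun_scale c f = (\<lambda>x. c * f x)"

lemma vector_space_cfun_scale: "vector_space cfun_scale"
  by unfold_locales (auto simp: cfun_scale_def fun_eq_iff algebra_simps)

definition exp_span :: "real set \<Rightarrow> (real \<Rightarrow> complex) set" where
  "exp_span \<Lambda> = module.span cfun_scale (expo ` \<Lambda>)"

lemma C_weighted_bounded:
  assumes \<psi>: "\<psi> \<in> {0..} \<rightarrow> {0..}" and f: "f \<in> C_weighted \<psi>"
  shows "bdd_above (range (\<lambda>x. cmod (f x) / exp (\<psi> \<bar>x\<bar>)))"
proof -
  from f have c: "continuous_on UNIV f"
    and l: "((\<lambda>x. f x / complex_of_real (exp (\<psi> \<bar>x\<bar>))) \<longlongrightarrow> 0) at_infinity"
    by (auto simp: C_weighted_def)
  from tendstoD[OF l, of 1] have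
    "\<forall>\<^sub>F x in at_infinity. cmod (f x) / exp (\<psi> \<bar>x\<bar>) < 1"
    by (simp add: norm_divide)
  then obtain B where B: "\<And>x. \<bar>x\<bar> \<ge> B \<Longrightarrow> cmod (f x) / exp (\<psi> \<bar>x\<bar>) < 1"
    by (auto simp: eventually_at_infinity)
  have "compact (f ` {-B..B})"
    by (intro compact_continuous_image continuous_on_subset[OF c]) auto
  then obtain K where K: "\<And>x. x \<in> {-B..B} \<Longrightarrow> cmod (f x) \<le> K"
    by (force dest!: compact_imp_bounded simp: bounded_iff)
  have "cmod (f x) / exp (\<psi> \<bar>x\<bar>) \<le> max 1 K" for x
  proof (cases "\<bar>x\<bar> \<ge> B")
    case True
    then show ?thesis using B[of x] by linarith
  next
    case False
    have "\<psi> \<bar>x\<bar> \<ge> 0" using \<psi> by (auto simp: Pi_iff)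
    then have "cmod (f x) / exp (\<psi> \<bar>x\<bar>) \<le> cmod (f x) / 1"
      by (intro divide_left_mono) auto
    also have "\<dots> \<le> K" using K[of x] False by (simp add: abs_less_iff not_le)
    finally show ?thesis by simp
  qed
  then show ?thesis by (intro bdd_aboveI2[where M = "max 1 K"])
qed

lemma C_weighted_diff:
  assumes "f \<in> C_weighted \<psi>" "g \<in> C_weighted \<psi>"
  shows "f - g \<in> C_weighted \<psi>"
proof -
  have "((\<lambda>x. f x / complex_of_real (exp (\<psi> \<bar>x\<bar>)) - g x / complex_of_real (exp (\<psi> \<bar>x\<bar>))) \<longlongrightarrow> 0 - 0)
      at_infinity"
    using assms by (intro tendsto_diff) (auto simp: C_weighted_def)
  moreover have "continuous_on UNIV (\<lambda>x. f x - g x)"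
    using assms by (intro continuous_on_diff) (auto simp: C_weighted_def)
  ultimately show ?thesis
    by (simp add: C_weighted_def diff_divide_distrib fun_diff_def)
qed

lemma weighted_norm_upper:
  assumes "\<psi> \<in> {0..} \<rightarrow> {0..}" "f \<in> C_weighted \<psi>"
  shows "cmod (f x) / exp (\<psi> \<bar>x\<bar>) \<le> weighted_norm \<psi> f"
  unfolding weighted_norm_def by (rule cSUP_upper[OF UNIV_I C_weighted_bounded[OF assms]])

lemma Metric_space_C_weighted:
  assumes \<psi>: "\<psi> \<in> {0..} \<rightarrow> {0..}"
  shows "Metric_space (C_weighted \<psi>) (weighted_dist \<psi>)"
proof
  fix f g
  show "0 \<le> weighted_dist \<psi> f g"
  proof (cases "f \<in> C_weighted \<psi> \<and> g \<in> C_weighted \<psi>")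
    case True
    then have "cmod ((f - g) 0) / exp (\<psi> \<bar>0\<bar>) \<le> weighted_norm \<psi> (f - g)"
      by (intro weighted_norm_upper[OF \<psi>] C_weighted_diff) auto
    moreover have "0 \<le> cmod ((f - g) 0) / exp (\<psi> \<bar>0\<bar>)" by simp
    ultimately have "0 \<le> weighted_norm \<psi> (f - g)" by (rule order_trans[rotated])
    then show ?thesis using True by (simp only: weighted_dist_def if_True simp_thms)
  qed (auto simp: weighted_dist_def)
  show "weighted_dist \<psi> f g = weighted_dist \<psi> g f"
    by (auto simp: weighted_dist_def weighted_norm_def norm_minus_commute)
  assume fg: "f \<in> C_weighted \<psi>" "g \<in> C_weighted \<psi>"
  show "weighted_dist \<psi> f g = 0 \<longleftrightarrow> f = g"
  proof
    assume "weighted_dist \<psi> f g = 0"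
    then have "cmod ((f - g) x) / exp (\<psi> \<bar>x\<bar>) \<le> 0" for x
      using weighted_norm_upper[OF \<psi> C_weighted_diff[OF fg], of x] fg
      by (simp add: weighted_dist_def)
    then show "f = g" by (auto simp: fun_eq_iff divide_le_0_iff)
  qed (auto simp: weighted_dist_def weighted_norm_def)
next
  fix f g h
  assume fgh: "f \<in> C_weighted \<psi>" "g \<in> C_weighted \<psi>" "h \<in> C_weighted \<psi>"
  have "cmod ((f - h) x) / exp (\<psi> \<bar>x\<bar>) \<le> weighted_norm \<psi> (f - g) + weighted_norm \<psi> (g - h)" for x
  proof -
    have "cmod (f x - h x) \<le> cmod (f x - g x) + cmod (g x - h x)"
      using norm_triangle_ineq[of "f x - g x" "g x - h x"] by simp
    then have "cmod ((f - h) x) / exp (\<psi> \<bar>x\<bar>)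
        \<le> cmod ((f - g) x) / exp (\<psi> \<bar>x\<bar>) + cmod ((g - h) x) / exp (\<psi> \<bar>x\<bar>)"
      by (simp add: add_divide_distrib[symmetric] divide_right_mono)
    also have "\<dots> \<le> weighted_norm \<psi> (f - g) + weighted_norm \<psi> (g - h)"
      using fgh by (intro add_mono weighted_norm_upper[OF \<psi>] C_weighted_diff)
    finally show ?thesis .
  qed
  then have "weighted_norm \<psi> (f - h) \<le> weighted_norm \<psi> (f - g) + weighted_norm \<psi> (g - h)"
    unfolding weighted_norm_def[of _ "f - h"] by (intro cSUP_least) auto
  then show "weighted_dist \<psi> f h \<le> weighted_dist \<psi> f g + weighted_dist \<psi> g h"
    using fgh by (simp add: weighted_dist_def)
qed

lemma C_weighted_dense_iff:
  assumes "\<psi> \<in> {0..} \<rightarrow> {0..}" "S \<subseteq> C_weighted \<psi>"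
  shows "C_weighted_topology \<psi> closure_of S = C_weighted \<psi> \<longleftrightarrow>
    (\<forall>f \<in> C_weighted \<psi>. \<forall>\<epsilon>>0. \<exists>g \<in> S. weighted_norm \<psi> (f - g) < \<epsilon>)"
proof -
  interpret Metric_space "C_weighted \<psi>" "weighted_dist \<psi>"
    by (rule Metric_space_C_weighted[OF assms(1)])
  have "C_weighted_topology \<psi> closure_of S =
      {f \<in> C_weighted \<psi>. \<forall>\<epsilon>>0. \<exists>g \<in> S. g \<in> mball f \<epsilon>}"
    unfolding C_weighted_topology_def by (rule metric_closure_of)
  also have "\<dots> = {f \<in> C_weighted \<psi>. \<forall>\<epsilon>>0. \<exists>g \<in> S. weighted_norm \<psi> (f - g) < \<epsilon>}"
  proof (rule Collect_cong, rule conj_cong[OF refl])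
    fix f assume f: "f \<in> C_weighted \<psi>"
    have "g \<in> mball f \<epsilon> \<longleftrightarrow> weighted_norm \<psi> (f - g) < \<epsilon>" if "g \<in> S" for g \<epsilon>
      using f that assms(2) by (simp add: weighted_dist_def subset_iff)
    then show "(\<forall>\<epsilon>>0. \<exists>g \<in> S. g \<in> mball f \<epsilon>) \<longleftrightarrow>
        (\<forall>\<epsilon>>0. \<exists>g \<in> S. weighted_norm \<psi> (f - g) < \<epsilon>)"
      by (simp cong: bex_cong)
  qed
  finally show ?thesis by blast
qed

end

(*
  No duality is needed: closeness to the span of the exponentials with frequencies in \<Lambda> is
  propagated directly from frequency to frequency.  If expo is approximable to accuracy
  q^(2n) at n well separated frequencies in an interval of length \<rho>, then Lagrange interpolation
  in the frequency variable makes expo l approximable to accuracy q^n for every l in that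
  interval: for |x| <= r the interpolation error is a Taylor remainder, which is small when
  \<rho> r is at most a small multiple of n, and for |x| > r the weight exp (\<psi> r) absorbs it.
  With n = 2^k and r chosen so that \<psi> r is a multiple of n, the set of good frequencies grows by
  about 2^k / r k when passing from accuracy q^(2^(k+1)) to q^(2^k).  Divergence of the integral
  of \<psi> is divergence of the sum of these steps, so starting from \<Lambda>, where the accuracy is
  perfect, every frequency is reached with arbitrarily good accuracy (compare Bang's proof of the
  Denjoy-Carleman theorem).  Trigonometric polynomials with arbitrary frequencies are dense by
  Stone-Weierstrass.
*)
theory Submission
  imports Defs
begin

subsection \<open>Lagrange interpolation at separated nodes\<close>

text \<open>Greedy choice: take the least point of \<open>E\<close>, which exists by compactness,
  and discard the window of length \<open>h\<close> to its right. Each choice costs measure at most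
  \<open>h\<close>, so \<open>n\<close> choices are possible.\<close>

lemma separated_points:
  fixes E :: "real set"
  assumes "compact E" "0 < h" "real n * h \<le> measure lebesgue E"
  shows "\<exists>t. (\<forall>j<n. t j \<in> E) \<and> (\<forall>j<n. \<forall>i<j. real (j - i) * h \<le> t j - t i)"
  using assms
proof (induction n arbitrary: E)
  case 0
  then show ?case by simp
next
  case (Suc n)
  have ne: "E \<noteq> {}" using Suc.prems(2,3) mult_pos_pos[of "1 + real n" h] by (auto simp: not_le[symmetric])
  obtain x0 where x0: "x0 \<in> E" "\<And>y. y \<in> E \<Longrightarrow> x0 \<le> y"
    using compact_attains_inf[OF Suc.prems(1) ne] by blast
  let ?E = "E \<inter> {x0 + h..}"
  have cE: "compact ?E" using Suc.prems(1) by (intro compact_Int_closed) auto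
  have lmE: "?E \<in> lmeasurable" using cE by (rule lmeasurable_compact)
  have "measure lebesgue E \<le> measure lebesgue ({x0..x0+h} \<union> ?E)"
    using x0 Suc.prems(1) lmE
    by (intro measure_mono_fmeasurable) (auto intro: lmeasurable_compact fmeasurableD)
  also have "\<dots> \<le> measure lebesgue {x0..x0+h} + measure lebesgue ?E"
    using lmE by (intro measure_Un_le) (auto intro: fmeasurableD)
  also have "measure lebesgue {x0..x0+h} = h" using Suc.prems(2) by simp
  finally have "real n * h \<le> measure lebesgue ?E" using Suc.prems(3) by (simp add: algebra_simps)
  from Suc.IH[OF cE Suc.prems(2) this] obtain t where t: "\<And>j. j < n \<Longrightarrow> t j \<in> ?E"
    "\<And>i j. j < n \<Longrightarrow> i < j \<Longrightarrow> real (j - i) * h \<le> t j - t i" by blast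
  let ?t = "\<lambda>j. case j of 0 \<Rightarrow> x0 | Suc j \<Rightarrow> t j"
  have "?t j \<in> E" if "j < Suc n" for j using that x0 t(1) by (auto split: nat.split)
  moreover have "real (j - i) * h \<le> ?t j - ?t i" if "j < Suc n" "i < j" for i j
  proof -
    obtain j' where j': "j = Suc j'" using \<open>i < j\<close> not0_implies_Suc[of j] by auto
    show ?thesis
    proof (cases i)
      case 0
      have "x0 + h \<le> t 0" using t(1)[of 0] that j' by auto
      moreover have "real j' * h \<le> t j' - t 0"
        using t(2)[of j' 0] that j' by (cases "j' = 0") auto
      ultimately show ?thesis using 0 j' by (simp add: algebra_simps)
    next
      case (Suc i')
      then show ?thesis using t(2)[of j' i'] that j' by auto
    qed
  qed
  ultimately show ?case by blast
qed

text \<open>The value at \<open>z\<close> rather than a polynomial, and over any field: the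
  interpolation identity is applied over the complex numbers, the size estimate over the
  reals.\<close>

definition lagrange_basis :: "(nat \<Rightarrow> 'a::field) \<Rightarrow> nat \<Rightarrow> nat \<Rightarrow> 'a \<Rightarrow> 'a" where
  "lagrange_basis t n j z = (\<Prod>i\<in>{..<n} - {j}. (z - t i) / (t j - t i))"

text \<open>The two sides are polynomials in \<open>z\<close> of degree below \<open>n\<close> that
  agree at the \<open>n\<close> nodes.\<close>

lemma lagrange_interpolation:
  fixes p :: "'a::field poly"
  assumes inj: "inj_on t {..<n}" and deg: "degree p < n"
  shows "poly p z = (\<Sum>j<n. lagrange_basis t n j z * poly p (t j))"
proof -
  define L where "L j = (\<Prod>i\<in>{..<n} - {j}. smult (inverse (t j - t i)) [:- t i, 1:])" for j
  have L: "poly (L j) z = lagrange_basis t n j z" for j z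
    unfolding L_def lagrange_basis_def by (simp add: poly_prod divide_inverse algebra_simps)
  have degL: "degree (L j) < n" if "j < n" for j
  proof -
    have "degree (L j) \<le> (\<Sum>i\<in>{..<n} - {j}. degree (smult (inverse (t j - t i)) [:- t i, 1:]))"
      unfolding L_def using degree_prod_sum_le[OF finite_Diff[OF finite_lessThan]] by (simp only: o_def)
    also have "\<dots> \<le> (\<Sum>i\<in>{..<n} - {j}. 1)" by (intro sum_mono) simp
    also have "\<dots> = n - 1" using that by simp
    finally show ?thesis using that by simp
  qed
  define q where "q = (\<Sum>j<n. smult (poly p (t j)) (L j))"
  have "p = q"
  proof (rule poly_eqI_degree[of "t ` {..<n}"])
    show "poly p x = poly q x" if x: "x \<in> t ` {..<n}" for x
    proof -
      obtain k where k: "k < n" "x = t k" using x by auto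
      have "lagrange_basis t n j (t k) = (if j = k then 1 else 0)" if "j < n" for j
      proof (cases "j = k")
        case True
        have "(t k - t i) / (t k - t i) = 1" if "i \<in> {..<n} - {k}" for i
          using that k inj by (auto simp: inj_on_def)
        then have "lagrange_basis t n k (t k) = 1"
          unfolding lagrange_basis_def by (intro prod.neutral) blast
        then show ?thesis using True by simp
      next
        case False
        then have "\<exists>i\<in>{..<n} - {j}. (t k - t i) / (t j - t i) = 0"
          using k by (intro bexI[of _ k]) auto
        then show ?thesis using False by (simp add: lagrange_basis_def)
      qed
      then have "poly q x = (\<Sum>j<n. if j = k then poly p (t j) else 0)"
        unfolding q_def poly_sum by (intro sum.cong) (auto simp: k(2) L)
      also have "\<dots> = poly p x" using k by simp
      finally show ?thesis by simp
    qed
    have "card (t ` {..<n}) = n" using inj by (simp add: card_image)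
    then show "degree p < card (t ` {..<n})" using deg by simp
    have "degree q \<le> n - 1" unfolding q_def
    proof (rule degree_sum_le)
      fix j assume "j \<in> {..<n}"
      then show "degree (smult (poly p (t j)) (L j)) \<le> n - 1"
        using degL[of j] degree_smult_le[of "poly p (t j)" "L j"] by simp
    qed simp
    then show "degree q < card (t ` {..<n})"
      using \<open>card _ = n\<close> deg by simp
  qed
  then have "poly p z = poly q z" by simp
  then show ?thesis by (simp add: q_def poly_sum L mult.commute)
qed

text \<open>\<open>n ^ n / fact n\<close> is one term of the series of \<open>exp n\<close>, and
  passing from \<open>fact n\<close> to \<open>fact (n - 1)\<close> costs a factor \<open>n\<close>,
  at most \<open>2 ^ n\<close>. The form with \<open>fact (n - 1)\<close> fits both the Lagrange sum
  and the Taylor remainder.\<close>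

lemma power_self_le_fact:
  assumes "n \<ge> 1"
  shows "real n ^ n \<le> (2 * exp 1) ^ n * fact (n - 1)"
proof -
  have "real n ^ n / fact n \<le> exp (real n)"
  proof -
    have "(\<Sum>k\<in>{n}. inverse (fact k) *\<^sub>R real n ^ k) \<le> (\<Sum>k. inverse (fact k) *\<^sub>R real n ^ k)"
      by (intro sum_le_suminf summable_exp_generic) auto
    then show ?thesis by (simp add: exp_def divide_inverse mult.commute)
  qed
  also have "exp (real n) = exp 1 ^ n" by (simp flip: exp_of_nat_mult)
  finally have "real n ^ n \<le> exp 1 ^ n * fact n" by (simp add: field_simps)
  also have "fact n = real n * fact (n - 1)" using assms by (simp add: fact_reduce)
  also have "exp 1 ^ n * (real n * fact (n - 1)) \<le> exp 1 ^ n * (2 ^ n * fact (n - 1))"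
    using of_nat_less_two_power[of n, where 'a = real]
    by (intro mult_left_mono mult_right_mono) (auto intro: less_imp_le)
  finally show ?thesis by (simp add: power_mult_distrib mult_ac)
qed

text \<open>Numerators are at most \<rho> and denominators at least |i - j| times the spacing, so
  the j-th term is at most a constant times the binomial coefficient
  \<open>(n - 1) choose j\<close>, and these add up to \<open>2 ^ (n - 1)\<close>. The spacing is
  proportional to \<rho>, so \<rho> cancels from the bound.\<close>

lemma sum_lagrange_basis_le:
  fixes t :: "nat \<Rightarrow> real"
  assumes n: "n \<ge> 1" and \<eta>: "0 < \<eta>" "\<eta> \<le> 1" and \<rho>: "0 < \<rho>"
    and sep: "\<And>i j. j < n \<Longrightarrow> i < j \<Longrightarrow> real (j - i) * (\<eta> * \<rho> / n) \<le> t j - t i"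
    and t: "\<And>j. j < n \<Longrightarrow> t j \<in> {u..u+\<rho>}" and z: "z \<in> {u..u+\<rho>}"
  shows "(\<Sum>j<n. \<bar>lagrange_basis t n j z\<bar>) \<le> (4 * exp 1 / \<eta>) ^ n"
proof -
  define h where "h = \<eta> * \<rho> / n"
  have h: "h > 0" using n \<eta> \<rho> by (simp add: h_def)
  define c where "c = (\<rho> / h) ^ (n - 1)"
  have fact1: "(\<Prod>i<j. real (j - i)) = fact j" for j
    by (induction j) (simp_all add: prod.lessThan_Suc_shift del: prod.lessThan_Suc)
  have fact2: "(\<Prod>i\<in>{j<..<n}. real (i - j)) = fact (n - 1 - j)" if "j < n" for j
  proof -
    have "(\<Prod>i\<in>{j<..<n}. real (i - j)) = (\<Prod>i\<in>{1..n-1-j}. real i)"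
      using that by (intro prod.reindex_bij_witness[of _ "\<lambda>i. i + j" "\<lambda>i. i - j"]) auto
    then show ?thesis by (simp add: fact_prod)
  qed
  have bound: "\<bar>lagrange_basis t n j z\<bar> \<le> c / fact (n - 1) * real ((n - 1) choose j)" if j: "j < n" for j
  proof -
    \<comment> \<open>The distance between \<open>i\<close> and \<open>j\<close>; the case
      distinction avoids truncated subtraction.\<close>
    let ?d = "\<lambda>i. if i < j then real (j - i) else real (i - j)"
    have split: "{..<n} - {j} = {..<j} \<union> {j<..<n}" using j by auto
    have "\<bar>lagrange_basis t n j z\<bar> = (\<Prod>i\<in>{..<n} - {j}. \<bar>z - t i\<bar> / \<bar>t j - t i\<bar>)"
      by (simp add: lagrange_basis_def abs_prod)
    also have "\<dots> \<le> (\<Prod>i\<in>{..<n} - {j}. \<rho> / (?d i * h))"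
    proof (intro prod_mono conjI frac_le)
      fix i assume i: "i \<in> {..<n} - {j}"
      show "\<bar>z - t i\<bar> \<le> \<rho>" using t[of i] z i by auto
      show "0 < ?d i * h" using i h by auto
      show "?d i * h \<le> \<bar>t j - t i\<bar>"
        using sep[of j i] sep[of i j] i j by (auto simp: h_def)
    qed (use \<rho> in auto)
    also have "\<dots> = c / (\<Prod>i\<in>{..<n} - {j}. ?d i)"
      using j by (simp add: c_def prod_dividef prod.distrib power_divide)
    also have "(\<Prod>i\<in>{..<n} - {j}. ?d i) = (\<Prod>i<j. ?d i) * (\<Prod>i\<in>{j<..<n}. ?d i)"
      unfolding split by (rule prod.union_disjoint) auto
    also have "(\<Prod>i<j. ?d i) = fact j"
      using fact1[of j] by (subst prod.cong[where h = "\<lambda>i. real (j - i)"]) auto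
    also have "(\<Prod>i\<in>{j<..<n}. ?d i) = fact (n - 1 - j)"
      using fact2[OF j] by (subst prod.cong[where h = "\<lambda>i. real (i - j)"]) auto
    also have "c / (fact j * fact (n - 1 - j)) = c / fact (n - 1) * real ((n - 1) choose j)"
      using j by (subst binomial_fact) auto
    finally show ?thesis .
  qed
  have "(\<Sum>j<n. \<bar>lagrange_basis t n j z\<bar>) \<le> (\<Sum>j<n. c / fact (n - 1) * real ((n - 1) choose j))"
    using bound by (intro sum_mono) auto
  also have "\<dots> = c / fact (n - 1) * real (\<Sum>j\<le>n - 1. (n - 1) choose j)"
  proof -
    have "{..<n} = {..n - 1}" using n by auto
    then show ?thesis by (simp add: sum_distrib_left)
  qed
  also have "\<dots> = c / fact (n - 1) * 2 ^ (n - 1)" by (simp add: choose_row_sum)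
  also have "\<dots> = (2 * real n / \<eta>) ^ (n - 1) / fact (n - 1)"
    using \<rho> by (simp add: c_def h_def power_mult_distrib power_divide)
  \<comment> \<open>The base is at least 1, so the exponent may be raised to \<open>n\<close>, where
    \<open>power_self_le_fact\<close> applies.\<close>
  also have "\<dots> \<le> (2 * real n / \<eta>) ^ n / fact (n - 1)"
    using n \<eta> by (intro divide_right_mono power_increasing) (auto simp: field_simps)
  also have "\<dots> = (2 / \<eta>) ^ n * (real n ^ n / fact (n - 1))"
    by (simp add: power_mult_distrib power_divide)
  also have "\<dots> \<le> (2 / \<eta>) ^ n * (2 * exp 1) ^ n"
    using power_self_le_fact[OF n] \<eta> by (intro mult_left_mono) (auto simp: field_simps)
  also have "\<dots> = (2 / \<eta> * (2 * exp 1)) ^ n" by (rule power_mult_distrib[symmetric])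
  also have "2 / \<eta> * (2 * exp 1) = 4 * exp 1 / \<eta>" by simp
  finally show ?thesis .
qed

subsection \<open>Weighted approximation by exponentials\<close>

interpretation cfun: vector_space cfun_scale
  by (rule vector_space_cfun_scale)

lemma exp_span_expo: "l \<in> \<Lambda> \<Longrightarrow> expo l \<in> exp_span \<Lambda>"
  unfolding exp_span_def by (intro cfun.span_base) auto

lemma exp_span_zero: "(\<lambda>x. 0) \<in> exp_span \<Lambda>"
  using cfun.span_zero[of "expo ` \<Lambda>"] by (simp add: exp_span_def zero_fun_def)

lemma exp_span_add:
  "f \<in> exp_span \<Lambda> \<Longrightarrow> g \<in> exp_span \<Lambda> \<Longrightarrow> (\<lambda>x. f x + g x) \<in> exp_span \<Lambda>"
  using cfun.span_add[of f "expo ` \<Lambda>" g] by (simp add: exp_span_def plus_fun_def)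

lemma exp_span_scale: "f \<in> exp_span \<Lambda> \<Longrightarrow> (\<lambda>x. c * f x) \<in> exp_span \<Lambda>"
  using cfun.span_scale[of f "expo ` \<Lambda>" c] by (simp add: exp_span_def cfun_scale_def)

lemma exp_span_induct [consumes 1, case_names zero step]:
  assumes "f \<in> exp_span \<Lambda>" "P (\<lambda>x. 0)"
    and "\<And>c l g. l \<in> \<Lambda> \<Longrightarrow> g \<in> exp_span \<Lambda> \<Longrightarrow> P g \<Longrightarrow> P (\<lambda>x. c * expo l x + g x)"
  shows "P f"
proof -
  \<comment> \<open>Membership is carried along with \<open>P\<close>, because the step case offers
    it for the partial sum \<open>g\<close>.\<close>
  have "f \<in> exp_span \<Lambda> \<and> P f"
    using assms(1)[unfolded exp_span_def]
  proof (induction rule: cfun.span_induct_alt)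
    case base
    then show ?case using assms(2) exp_span_zero[of \<Lambda>] by (simp add: zero_fun_def)
  next
    case (step c e g)
    then obtain l where l: "l \<in> \<Lambda>" "e = expo l" by auto
    have "cfun_scale c e + g = (\<lambda>x. c * expo l x + g x)"
      by (simp add: l cfun_scale_def plus_fun_def)
    then show ?case
      using assms(3)[OF l(1)] step exp_span_add[OF exp_span_scale[OF exp_span_expo[OF l(1)]], of g c]
      by simp
  qed
  then show ?thesis ..
qed

lemma norm_expo [simp]: "cmod (expo l x) = 1"
  by (simp add: expo_def)

lemma expo_mult: "expo a x * expo b x = expo (a + b) x"
  by (simp add: expo_def algebra_simps flip: exp_add)

text \<open>Stated without \<^const>\<open>weighted_norm\<close>, so that \<open>f\<close> need not lie in the weighted space.\<close>

definition weighted_approx ::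
    "(real \<Rightarrow> real) \<Rightarrow> real set \<Rightarrow> (real \<Rightarrow> complex) \<Rightarrow> real \<Rightarrow> bool" where
  "weighted_approx \<psi> \<Lambda> f a \<longleftrightarrow> (\<exists>g\<in>exp_span \<Lambda>. \<forall>x. cmod (f x - g x) \<le> a * exp (\<psi> \<bar>x\<bar>))"

lemma weighted_approx_exp_span: "f \<in> exp_span \<Lambda> \<Longrightarrow> weighted_approx \<psi> \<Lambda> f 0"
  unfolding weighted_approx_def by (intro bexI[of _ f]) auto

lemma weighted_approx_mono: "weighted_approx \<psi> \<Lambda> f a \<Longrightarrow> a \<le> b \<Longrightarrow> weighted_approx \<psi> \<Lambda> f b"
  unfolding weighted_approx_def by (meson exp_ge_zero mult_right_mono order_trans)

lemma weighted_approx_add: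
  assumes "weighted_approx \<psi> \<Lambda> f a" "weighted_approx \<psi> \<Lambda> g b"
  shows "weighted_approx \<psi> \<Lambda> (\<lambda>x. f x + g x) (a + b)"
proof -
  obtain f' g' where f': "f' \<in> exp_span \<Lambda>" "\<And>x. cmod (f x - f' x) \<le> a * exp (\<psi> \<bar>x\<bar>)"
    and g': "g' \<in> exp_span \<Lambda>" "\<And>x. cmod (g x - g' x) \<le> b * exp (\<psi> \<bar>x\<bar>)"
    using assms by (auto simp: weighted_approx_def)
  have "cmod (f x + g x - (f' x + g' x)) \<le> (a + b) * exp (\<psi> \<bar>x\<bar>)" for x
    using norm_triangle_mono[OF f'(2)[of x] g'(2)[of x]] by (simp add: algebra_simps)
  then show ?thesis
    unfolding weighted_approx_def using exp_span_add[OF f'(1) g'(1)] by (intro bexI) auto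
qed

lemma weighted_approx_scale:
  assumes "weighted_approx \<psi> \<Lambda> f a"
  shows "weighted_approx \<psi> \<Lambda> (\<lambda>x. c * f x) (cmod c * a)"
proof -
  obtain f' where f': "f' \<in> exp_span \<Lambda>" "\<And>x. cmod (f x - f' x) \<le> a * exp (\<psi> \<bar>x\<bar>)"
    using assms by (auto simp: weighted_approx_def)
  have "cmod (c * f x - c * f' x) \<le> cmod c * a * exp (\<psi> \<bar>x\<bar>)" for x
    using mult_left_mono[OF f'(2)[of x], of "cmod c"]
    by (simp add: norm_mult mult.assoc flip: right_diff_distrib)
  then show ?thesis
    unfolding weighted_approx_def using exp_span_scale[OF f'(1)] by (intro bexI) auto
qed

lemma weighted_approx_sum:
  fixes n :: nat
  assumes "\<And>j. j < n \<Longrightarrow> weighted_approx \<psi> \<Lambda> (f j) a"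
  shows "weighted_approx \<psi> \<Lambda> (\<lambda>x. \<Sum>j<n. c j * f j x) ((\<Sum>j<n. cmod (c j)) * a)"
  using assms
proof (induction n)
  case 0
  then show ?case using weighted_approx_exp_span[OF exp_span_zero] by simp
next
  case (Suc n)
  from Suc.IH[OF Suc.prems] weighted_approx_scale[OF Suc.prems[of n], of "c n"]
  show ?case by (auto dest: weighted_approx_add simp: algebra_simps)
qed

lemma weighted_approx_perturb:
  assumes "weighted_approx \<psi> \<Lambda> g b" "\<And>x. cmod (f x - g x) \<le> a * exp (\<psi> \<bar>x\<bar>)"
  shows "weighted_approx \<psi> \<Lambda> f (a + b)"
proof -
  obtain g' where g': "g' \<in> exp_span \<Lambda>" "\<And>x. cmod (g x - g' x) \<le> b * exp (\<psi> \<bar>x\<bar>)"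
    using assms by (auto simp: weighted_approx_def)
  have "cmod (f x - g' x) \<le> (a + b) * exp (\<psi> \<bar>x\<bar>)" for x
    using norm_triangle_mono[OF assms(2)[of x] g'(2)[of x]] by (simp add: algebra_simps)
  then show ?thesis unfolding weighted_approx_def using g'(1) by blast
qed

section \<open>From separated frequencies to a whole interval of frequencies\<close>

text \<open>Split off the unimodular factor \<open>expo u x\<close>. As a function of the frequency,
  the rest is a Taylor polynomial of degree below \<open>n\<close>, which interpolation reproduces
  exactly, plus a remainder. Only remainders survive: one at \<open>l\<close>, and one at each node
  weighted by its basis value.\<close>

lemma expo_lagrange_error:
  fixes t :: "nat \<Rightarrow> real"
  assumes n: "n \<ge> 1" and inj: "inj_on t {..<n}"
    and t: "\<And>j. j < n \<Longrightarrow> t j \<in> {u..u+\<rho>}" and l: "l \<in> {u..u+\<rho>}" and x: "\<bar>x\<bar> \<le> r"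
  shows "cmod (expo l x - (\<Sum>j<n. of_real (lagrange_basis t n j l) * expo (t j) x))
    \<le> (1 + (\<Sum>j<n. \<bar>lagrange_basis t n j l\<bar>)) * ((\<rho> * r) ^ n / fact (n - 1))"
proof -
  \<comment> \<open>For fixed \<open>x\<close>, \<open>p\<close> is the Taylor polynomial at
    frequency 0 of the exponential as a function of the frequency; \<open>R s\<close> is the
    remainder at \<open>s - u\<close>.\<close>
  define p :: "complex poly" where "p = (\<Sum>k\<le>n-1. monom ((- \<i> * x) ^ k / fact k) k)"
  define R where "R s = expo (s - u) x - poly p (of_real (s - u))" for s
  let ?L = "\<lambda>j. complex_of_real (lagrange_basis t n j l)"
  have R: "cmod (R s) \<le> (\<rho> * r) ^ n / fact (n - 1)" if "s \<in> {u..u+\<rho>}" for s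
  proof -
    let ?z = "- \<i> * complex_of_real (s - u) * complex_of_real x"
    have "R s = exp ?z - (\<Sum>k\<le>n-1. ?z ^ k / fact k)"
      by (simp add: R_def p_def expo_def poly_sum poly_monom power_mult_distrib mult_ac power_minus[of "\<i> * _"])
    \<comment> \<open>The factor exp |Re z| of the Taylor bound is 1, since \<open>?z\<close> is
      purely imaginary.\<close>
    then have "cmod (R s) \<le> cmod ?z ^ n / fact (n - 1)"
      using Taylor_exp[of ?z "n - 1"] n by simp
    also have "cmod ?z = \<bar>s - u\<bar> * \<bar>x\<bar>"
      by (simp only: norm_mult norm_minus_cancel norm_ii norm_of_real mult_1_left)
    also have "(\<bar>s - u\<bar> * \<bar>x\<bar>) ^ n / fact (n - 1) \<le> (\<rho> * r) ^ n / fact (n - 1)"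
      using that x by (intro divide_right_mono power_mono mult_mono) auto
    finally show ?thesis .
  qed
  have "poly p (of_real (l - u)) =
      (\<Sum>j<n. lagrange_basis (\<lambda>j. complex_of_real (t j - u)) n j (of_real (l - u)) * poly p (of_real (t j - u)))"
  proof (rule lagrange_interpolation)
    show "inj_on (\<lambda>j. complex_of_real (t j - u)) {..<n}" using inj by (auto simp: inj_on_def)
    have "degree p \<le> n - 1" unfolding p_def
      by (intro degree_sum_le) (auto intro: order_trans[OF degree_monom_le])
    then show "degree p < n" using n by simp
  qed
  \<comment> \<open>The shift by \<open>u\<close> cancels in every difference, so the complex basis
    values are the real ones.\<close>
  also have "\<dots> = (\<Sum>j<n. ?L j * poly p (of_real (t j - u)))"
    by (simp add: lagrange_basis_def)
  finally have p: "poly p (of_real (l - u)) = \<dots>" .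
  have e: "expo s x = expo u x * (poly p (of_real (s - u)) + R s)" for s
    by (simp add: R_def expo_mult)
  have "expo l x - (\<Sum>j<n. ?L j * expo (t j) x) = expo u x * (R l - (\<Sum>j<n. ?L j * R (t j)))"
    unfolding e[of l] e[of "t _"] p
    by (simp add: algebra_simps sum.distrib sum_distrib_left)
  also have "cmod \<dots> \<le> cmod (R l) + (\<Sum>j<n. \<bar>lagrange_basis t n j l\<bar> * cmod (R (t j)))"
    unfolding norm_mult norm_expo mult_1_left
    by (intro order_trans[OF norm_triangle_ineq4] add_left_mono order_trans[OF norm_sum] sum_mono)
       (simp add: norm_mult)
  also have "\<dots> \<le> (\<rho> * r) ^ n / fact (n - 1) +
      (\<Sum>j<n. \<bar>lagrange_basis t n j l\<bar> * ((\<rho> * r) ^ n / fact (n - 1)))"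
    using R t l by (intro add_mono sum_mono mult_left_mono) auto
  also have "\<dots> = (1 + (\<Sum>j<n. \<bar>lagrange_basis t n j l\<bar>)) * ((\<rho> * r) ^ n / fact (n - 1))"
    unfolding distrib_right sum_distrib_right by simp
  finally show ?thesis .
qed

text \<open>The constant \<open>q\<close> turns the bound of \<open>sum_lagrange_basis_le\<close>
  into \<open>B \<le> (1 / (3 * q)) ^ n\<close>. The interpolation error is at most
  \<open>(1 + B) * q ^ (2 * n)\<close> relative to the weight, and replacing the exponentials at the
  nodes by their approximations adds \<open>B * q ^ (2 * n)\<close>. Half of the exponent
  \<open>2 * n\<close> pays for \<open>B\<close>.\<close>

lemma weighted_approx_extend:
  assumes \<psi>: "mono_on {0..} \<psi>" "\<psi> \<in> {0..} \<rightarrow> {0..}"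
    and n: "n \<ge> 1" and \<eta>: "0 < \<eta>" "\<eta> \<le> 1" and q: "q = \<eta> / (12 * exp 1)"
    and \<rho>: "0 < \<rho>" and r: "0 < r" "exp (- \<psi> r) \<le> q ^ (2 * n)" "2 * exp 1 * \<rho> * r \<le> q\<^sup>2 * n"
    and E: "compact E" "E \<subseteq> {u..u+\<rho>}" "\<eta> * \<rho> \<le> measure lebesgue E"
    and approx: "\<And>m. m \<in> E \<Longrightarrow> weighted_approx \<psi> \<Lambda> (expo m) (q ^ (2 * n))"
    and l: "l \<in> {u..u+\<rho>}"
  shows "weighted_approx \<psi> \<Lambda> (expo l) (q ^ n)"
proof -
  have q0: "q > 0" using q \<eta> by simp
  have "0 < \<eta> * \<rho> / n" using n \<eta> \<rho> by simp
  moreover have "real n * (\<eta> * \<rho> / n) \<le> measure lebesgue E" using n E(3) by simp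
  ultimately obtain t where tE: "\<And>j. j < n \<Longrightarrow> t j \<in> E"
    and sep: "\<And>i j. j < n \<Longrightarrow> i < j \<Longrightarrow> real (j - i) * (\<eta> * \<rho> / n) \<le> t j - t i"
    using separated_points[OF E(1)] by metis
  have t: "\<And>j. j < n \<Longrightarrow> t j \<in> {u..u+\<rho>}" using tE E(2) by blast
  have "t i < t j" if "i < j" "j < n" for i j
  proof -
    have "0 < real (j - i) * (\<eta> * \<rho> / n)" using that n \<eta> \<rho> by (intro mult_pos_pos) auto
    then show ?thesis using sep[OF that(2,1)] by linarith
  qed
  then have inj: "inj_on t {..<n}" by (intro linorder_inj_onI) (auto simp: less_imp_neq)
  define B where "B = (\<Sum>j<n. \<bar>lagrange_basis t n j l\<bar>)"
  have B0: "0 \<le> B" by (simp add: B_def sum_nonneg)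
  have BK: "B \<le> (1 / (3 * q)) ^ n"
    using sum_lagrange_basis_le[OF n \<eta> \<rho> sep t l] by (simp add: B_def q)
  \<comment> \<open>The factor \<open>2 * exp 1\<close> in the hypothesis on \<open>r\<close>
    cancels the one lost in \<open>power_self_le_fact\<close>.\<close>
  have taylor: "(\<rho> * r) ^ n / fact (n - 1) \<le> q ^ (2 * n)"
  proof -
    have "(2 * exp 1 * \<rho> * r) ^ n \<le> (q\<^sup>2 * n) ^ n"
      using \<rho> r by (intro power_mono) auto
    also have "\<dots> = q ^ (2 * n) * real n ^ n" by (simp add: power_mult_distrib power_mult)
    also have "\<dots> \<le> q ^ (2 * n) * ((2 * exp 1) ^ n * fact (n - 1))"
      using power_self_le_fact[OF n] q0 by (intro mult_left_mono) auto
    finally have "(2 * exp 1) ^ n * (\<rho> * r) ^ n \<le> (2 * exp 1) ^ n * (q ^ (2 * n) * fact (n - 1))"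
      by (simp add: power_mult_distrib mult_ac)
    then have "(\<rho> * r) ^ n \<le> q ^ (2 * n) * fact (n - 1)"
      by (subst (asm) mult_le_cancel_left_pos) auto
    then show ?thesis by (simp add: field_simps)
  qed
  have "cmod (expo l x - (\<Sum>j<n. of_real (lagrange_basis t n j l) * expo (t j) x))
      \<le> ((1 + B) * q ^ (2 * n)) * exp (\<psi> \<bar>x\<bar>)" for x
  proof (cases "\<bar>x\<bar> \<le> r")
    case True
    have "cmod (expo l x - (\<Sum>j<n. of_real (lagrange_basis t n j l) * expo (t j) x))
        \<le> (1 + B) * ((\<rho> * r) ^ n / fact (n - 1))"
      unfolding B_def by (rule expo_lagrange_error[OF n inj t l True])
    also have "\<dots> \<le> (1 + B) * q ^ (2 * n) * 1"
      unfolding mult_1_right using taylor B0 by (intro mult_left_mono) auto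
    also have "\<dots> \<le> (1 + B) * q ^ (2 * n) * exp (\<psi> \<bar>x\<bar>)"
      using \<psi>(2) B0 q0 by (intro mult_left_mono) (auto simp: Pi_iff)
    finally show ?thesis .
  next
    case False
    \<comment> \<open>Beyond \<open>r\<close> the trivial bound by the triangle inequality suffices,
      as the weight is at least \<open>exp (\<psi> r)\<close>.\<close>
    have "cmod (expo l x - (\<Sum>j<n. of_real (lagrange_basis t n j l) * expo (t j) x)) \<le> 1 + B"
      unfolding B_def
      by (intro order_trans[OF norm_triangle_ineq4] add_mono order_trans[OF norm_sum] sum_mono)
         (auto simp: norm_mult)
    also have "\<dots> = (1 + B) * (exp (- \<psi> r) * exp (\<psi> r))" by (simp flip: exp_add)
    also have "\<dots> \<le> (1 + B) * (q ^ (2 * n) * exp (\<psi> \<bar>x\<bar>))"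
      using r False B0 \<psi>(1) by (intro mult_left_mono mult_mono) (auto simp: mono_on_def)
    finally show ?thesis by (simp add: mult.assoc)
  qed
  from weighted_approx_perturb[OF weighted_approx_sum[OF approx[OF tE]] this]
  have "weighted_approx \<psi> \<Lambda> (expo l) ((1 + B) * q ^ (2 * n) + B * q ^ (2 * n))"
    by (simp add: B_def)
  moreover have "(1 + B) * q ^ (2 * n) + B * q ^ (2 * n) \<le> q ^ n"
  proof -
    \<comment> \<open>Each of the three summands 1, \<open>B\<close>, \<open>B\<close> is at most
      \<open>?K ^ n\<close>; the 3 in the denominator of \<open>?K\<close> absorbs their
      number.\<close>
    let ?K = "1 / (3 * q)"
    have "q \<le> 1 / (12 * 1)" unfolding q using \<eta> by (intro frac_le mult_left_mono) auto
    then have "1 \<le> ?K ^ n" using q0 by (intro one_le_power) (simp add: field_simps)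
    then have "(1 + B) + B \<le> 3 * ?K ^ n" using BK by simp
    also have "\<dots> \<le> 3 ^ n * ?K ^ n"
      using n q0 power_increasing[of 1 n "3 :: real"] by (intro mult_right_mono) auto
    also have "\<dots> = (1 / q) ^ n" by (simp flip: power_mult_distrib)
    finally have "((1 + B) + B) * q ^ (2 * n) \<le> (1 / q) ^ n * q ^ (2 * n)"
      using q0 by (intro mult_right_mono) auto
    also have "\<dots> = q ^ n" using q0 by (simp add: mult_2 power_add power_divide)
    finally show ?thesis by (simp add: algebra_simps)
  qed
  ultimately show ?thesis by (rule weighted_approx_mono)
qed

subsection \<open>Growth of the set of approximable frequencies\<close>

text \<open>Pigeonhole: at most \<open>2 * M / \<rho> + 1\<close> cells of length \<rho> cover
  \<open>{-M..M}\<close>, so if all were sparse, \<open>E\<close> would have measure below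
  \<open>\<eta> * (2 * M + \<rho>)\<close>. The same density \<eta> works at every scale
  \<open>\<rho> \<le> 1\<close>, which lets a single \<open>q\<close> serve all steps.\<close>

lemma exists_dense_cell:
  fixes E :: "real set"
  assumes E: "E \<in> lmeasurable" "E \<subseteq> {-M..M}" and M: "0 \<le> M" and \<rho>: "0 < \<rho>" "\<rho> \<le> 1"
    and \<eta>: "0 < \<eta>" "\<eta> * (2 * M + 1) \<le> measure lebesgue E"
  shows "\<exists>u\<in>{-M..M}. \<eta> * \<rho> \<le> measure lebesgue (E \<inter> {u..u+\<rho>})"
proof (rule ccontr)
  assume "\<not> ?thesis"
  then have small: "measure lebesgue (E \<inter> {u..u+\<rho>}) < \<eta> * \<rho>" if "u \<in> {-M..M}" for u
    using that by force
  \<comment> \<open>The index of the last cell: the cells with \<open>j \<le> K\<close> start inside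
    \<open>{-M..M}\<close> and still cover it.\<close>
  define K where "K = nat \<lfloor>2 * M / \<rho>\<rfloor>"
  have K: "real K \<le> 2 * M / \<rho>" using M \<rho> by (simp add: K_def)
  define c where "c j = - M + real j * \<rho>" for j
  have c: "c j \<in> {-M..M}" if "j \<le> K" for j
  proof -
    have "real j * \<rho> \<le> 2 * M / \<rho> * \<rho>" using that K \<rho> by (intro mult_right_mono) linarith+
    then show ?thesis using \<rho> by (simp add: c_def)
  qed
  have lm: "E \<inter> {c j..c j + \<rho>} \<in> lmeasurable" for j
    using E(1) by (intro fmeasurable_Int_fmeasurable) auto
  have "E \<subseteq> (\<Union>j\<le>K. E \<inter> {c j..c j + \<rho>})"
  proof
    fix x assume x: "x \<in> E"
    then have xM: "-M \<le> x" "x \<le> M" using E(2) by auto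
    define j where "j = nat \<lfloor>(x + M) / \<rho>\<rfloor>"
    have "\<lfloor>(x + M) / \<rho>\<rfloor> \<le> \<lfloor>2 * M / \<rho>\<rfloor>"
      using xM \<rho> by (intro floor_mono divide_right_mono) auto
    then have "j \<le> K" by (simp add: j_def K_def nat_mono)
    moreover have "real j \<le> (x + M) / \<rho>" "(x + M) / \<rho> \<le> real j + 1"
      using xM \<rho> by (auto simp: j_def)
    then have "x \<in> {c j..c j + \<rho>}" using \<rho> by (simp add: c_def field_simps)
    ultimately show "x \<in> (\<Union>j\<le>K. E \<inter> {c j..c j + \<rho>})" using x by blast
  qed
  then have "measure lebesgue E \<le> measure lebesgue (\<Union>j\<le>K. E \<inter> {c j..c j + \<rho>})"
    using E(1) lm by (intro measure_mono_fmeasurable fmeasurable.finite_UN) (auto intro: fmeasurableD)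
  also have "\<dots> \<le> (\<Sum>j\<le>K. measure lebesgue (E \<inter> {c j..c j + \<rho>}))"
    using lm by (intro measure_UNION_le) (auto intro: fmeasurableD)
  also have "\<dots> < (\<Sum>j\<le>K. \<eta> * \<rho>)" using small[OF c] by (intro sum_strict_mono) auto
  also have "\<dots> = (real K + 1) * (\<eta> * \<rho>)" by simp
  also have "\<dots> \<le> (2 * M / \<rho> + 1) * (\<eta> * \<rho>)" using K \<eta> \<rho> by (intro mult_right_mono) auto
  also have "\<dots> = \<eta> * (2 * M + \<rho>)" using \<rho> by (simp add: field_simps)
  also have "\<dots> \<le> \<eta> * (2 * M + 1)" using \<eta> \<rho> by (intro mult_left_mono) auto
  finally show False using \<eta> by simp
qed

text \<open>The bound on the centre does not depend on \<open>R\<close>, so a large \<open>R\<close>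
  captures any prescribed frequency. The margin 1 leaves room for centres
  \<open>u + \<rho>/2\<close> with \<open>u\<close> in \<open>{-M..M}\<close>.\<close>

definition approx_on_interval ::
    "(real \<Rightarrow> real) \<Rightarrow> real set \<Rightarrow> real \<Rightarrow> real \<Rightarrow> real \<Rightarrow> bool" where
  "approx_on_interval \<psi> \<Lambda> M a R \<longleftrightarrow>
    (\<exists>c. \<bar>c\<bar> \<le> M + 1 \<and> (\<forall>l. \<bar>l - c\<bar> \<le> R \<longrightarrow> weighted_approx \<psi> \<Lambda> (expo l) a))"

text \<open>Halving the exponent of the accuracy buys \<rho>/4 in radius. The bound
  \<open>\<eta> \<le> 1 / 4\<close> lets an end piece of length \<rho>/4 act as the dense set in
  \<open>weighted_approx_extend\<close>.\<close>

lemma approx_on_interval_enlarge: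
  assumes \<psi>: "mono_on {0..} \<psi>" "\<psi> \<in> {0..} \<rightarrow> {0..}" and \<Lambda>: "closed \<Lambda>"
    and n: "n \<ge> 1" and \<eta>: "0 < \<eta>" "\<eta> \<le> 1 / 4" and q: "q = \<eta> / (12 * exp 1)"
    and \<rho>: "0 < \<rho>" "\<rho> \<le> 1"
    and r: "0 < r" "exp (- \<psi> r) \<le> q ^ (2 * n)" "2 * exp 1 * \<rho> * r \<le> q\<^sup>2 * n"
    and cell: "\<exists>u\<in>{-M..M}. \<eta> * \<rho> \<le> measure lebesgue (\<Lambda> \<inter> {u..u+\<rho>})"
    and approx: "approx_on_interval \<psi> \<Lambda> M (q ^ (2 * n)) R"
  shows "approx_on_interval \<psi> \<Lambda> M (q ^ n) (R + \<rho> / 4)"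
proof -
  have \<eta>1: "\<eta> \<le> 1" using \<eta> by simp
  note extend = weighted_approx_extend[OF \<psi> n \<eta>(1) \<eta>1 q \<rho>(1) r]
  have q0: "0 < q" using q \<eta> by simp
  have "q \<le> 1 / (12 * 1)" unfolding q using \<eta> by (intro frac_le mult_left_mono) auto
  then have q1: "q \<le> 1" by simp
  show ?thesis
    \<comment> \<open>A long interval is extended at both ends. A short one is discarded, and a new one is
      started from a piece of \<open>\<Lambda>\<close>: this is why the centre of the interval has to float.\<close>
  proof (cases "\<rho> / 4 \<le> R")
    case True
    from approx obtain c where c: "\<bar>c\<bar> \<le> M + 1"
      "\<And>l. \<bar>l - c\<bar> \<le> R \<Longrightarrow> weighted_approx \<psi> \<Lambda> (expo l) (q ^ (2 * n))"
      unfolding approx_on_interval_def by blast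
    have \<eta>\<rho>: "\<eta> * \<rho> \<le> \<rho> / 4" using \<eta> \<rho> mult_right_mono[of \<eta> "1/4" \<rho>] by simp
    have "weighted_approx \<psi> \<Lambda> (expo l) (q ^ n)" if l: "\<bar>l - c\<bar> \<le> R + \<rho> / 4" for l
    proof -
      consider "\<bar>l - c\<bar> \<le> R" | "c + R < l" | "l < c - R" by linarith
      then show ?thesis
      proof cases
        case 1
        have "q ^ (2 * n) \<le> q ^ n" using q0 q1 by (intro power_decreasing) auto
        then show ?thesis using c(2)[OF 1] weighted_approx_mono by blast
      next
        \<comment> \<open>The last quarter cell of the interval supplies the nodes, and
          \<open>l\<close> lies within the next \<rho>/4.\<close>
        case 2
        show ?thesis
        proof (rule extend)
          show "{c + R - \<rho>/4..c + R} \<subseteq> {c + R - \<rho>/4..c + R - \<rho>/4 + \<rho>}" using \<rho> by auto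
          show "\<eta> * \<rho> \<le> measure lebesgue {c + R - \<rho>/4..c + R}" using \<eta>\<rho> \<rho> by simp
          show "weighted_approx \<psi> \<Lambda> (expo m) (q ^ (2 * n))" if "m \<in> {c + R - \<rho>/4..c + R}" for m
            using that True \<rho> by (intro c(2)) auto
          show "l \<in> {c + R - \<rho>/4..c + R - \<rho>/4 + \<rho>}" using 2 l \<rho> by auto
        qed simp
      next
        case 3
        show ?thesis
        proof (rule extend)
          show "{c - R..c - R + \<rho>/4} \<subseteq> {c - R - \<rho>/4..c - R - \<rho>/4 + \<rho>}" using \<rho> by auto
          show "\<eta> * \<rho> \<le> measure lebesgue {c - R..c - R + \<rho>/4}" using \<eta>\<rho> \<rho> by simp
          show "weighted_approx \<psi> \<Lambda> (expo m) (q ^ (2 * n))" if "m \<in> {c - R..c - R + \<rho>/4}" for m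
            using that True \<rho> by (intro c(2)) auto
          show "l \<in> {c - R - \<rho>/4..c - R - \<rho>/4 + \<rho>}" using 3 l \<rho> by auto
        qed simp
      qed
    qed
    then show ?thesis unfolding approx_on_interval_def using c(1) by blast
  next
    case False
    from cell obtain u where u: "u \<in> {-M..M}" "\<eta> * \<rho> \<le> measure lebesgue (\<Lambda> \<inter> {u..u+\<rho>})" by blast
    \<comment> \<open>As \<open>R < \<rho>/4\<close>, the new radius is below \<rho>/2, so one cell
      around \<open>u + \<rho>/2\<close> contains the new interval; on \<Lambda> itself the error is
      0.\<close>
    have "weighted_approx \<psi> \<Lambda> (expo l) (q ^ n)" if "\<bar>l - (u + \<rho>/2)\<bar> \<le> R + \<rho> / 4" for l
    proof (rule extend)
      show "compact (\<Lambda> \<inter> {u..u+\<rho>})" using \<Lambda> by (intro closed_Int_compact) auto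
      show "\<Lambda> \<inter> {u..u+\<rho>} \<subseteq> {u..u+\<rho>}" by simp
      show "weighted_approx \<psi> \<Lambda> (expo m) (q ^ (2 * n))" if "m \<in> \<Lambda> \<inter> {u..u+\<rho>}" for m
        using that q0 by (intro weighted_approx_mono[OF weighted_approx_exp_span] exp_span_expo) auto
      show "l \<in> {u..u+\<rho>}" using that False by (auto simp: abs_le_iff)
    qed (rule u)
    moreover have "\<bar>u + \<rho>/2\<bar> \<le> M + 1" using u \<rho> by auto
    ultimately show ?thesis unfolding approx_on_interval_def by blast
  qed
qed

section \<open>From divergence of the integral to divergence of the steps\<close>

text \<open>Beyond \<open>D\<close> the integrand is dominated by the sum of the functions
  \<open>b k / x\<^sup>2\<close> on \<open>{a k..}\<close>, whose integrals are
  \<open>b k / a k\<close>; on \<open>{0..D}\<close> it is at most \<open>C\<close>.\<close>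

lemma nn_integral_weight_finite:
  fixes \<psi> :: "real \<Rightarrow> real" and a b :: "nat \<Rightarrow> real"
  assumes C: "0 \<le> C" and a: "\<And>k. 0 < a k" and b: "\<And>k. 0 \<le> b k" and sum: "summable (\<lambda>k. b k / a k)"
    and small: "\<And>x. 0 \<le> x \<Longrightarrow> x \<le> D \<Longrightarrow> \<psi> x \<le> C"
    and large: "\<And>x. 0 \<le> x \<Longrightarrow> D < x \<Longrightarrow> \<exists>k. a k \<le> x \<and> \<psi> x \<le> b k"
  shows "(\<integral>\<^sup>+ x\<in>{0..}. ennreal (\<psi> x / (1 + x\<^sup>2)) \<partial>lborel) < \<infinity>"
proof -
  let ?g = "\<lambda>k x. ennreal (b k / x\<^sup>2) * indicator {a k..} x"
  have tail: "(\<integral>\<^sup>+ x. ?g k x \<partial>lborel) = ennreal (b k / a k)" for k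
  proof -
    have "(\<integral>\<^sup>+ x. ?g k x \<partial>lborel) = ennreal (0 - (- b k / a k))"
    proof (rule nn_integral_FTC_atLeast)
      show "((\<lambda>x. - b k / x) has_real_derivative b k / x\<^sup>2) (at x)" if "a k \<le> x" for x
        using that a[of k] by (auto intro!: derivative_eq_intros simp: power2_eq_square)
      show "((\<lambda>x. - b k / x) \<longlongrightarrow> 0) at_top"
        by (intro tendsto_divide_0[OF tendsto_const] filterlim_at_top_imp_at_infinity filterlim_ident)
    qed (use b in auto)
    then show ?thesis by simp
  qed
  have "(\<integral>\<^sup>+ x\<in>{0..}. ennreal (\<psi> x / (1 + x\<^sup>2)) \<partial>lborel)
      \<le> (\<integral>\<^sup>+ x. ennreal C * indicator {0..D} x + (\<Sum>k. ?g k x) \<partial>lborel)"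
  proof (rule nn_integral_mono)
    fix x :: real
    show "ennreal (\<psi> x / (1 + x\<^sup>2)) * indicator {0..} x
        \<le> ennreal C * indicator {0..D} x + (\<Sum>k. ?g k x)"
    proof (cases "0 \<le> x")
      case x: True
      show ?thesis
      proof (cases "x \<le> D")
        case True
        have "\<psi> x / (1 + x\<^sup>2) \<le> C / 1" using small[OF x True] C by (intro frac_le) auto
        then have "ennreal (\<psi> x / (1 + x\<^sup>2)) \<le> ennreal C" by (intro ennreal_leI) simp
        also have "\<dots> \<le> ennreal C + (\<Sum>k. ?g k x)" by simp
        finally show ?thesis using x True by simp
      next
        case False
        then obtain k where k: "a k \<le> x" "\<psi> x \<le> b k" using large[OF x] by auto
        have "\<psi> x / (1 + x\<^sup>2) \<le> b k / x\<^sup>2" using k b[of k] a[of k] by (intro frac_le) auto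
        then have "ennreal (\<psi> x / (1 + x\<^sup>2)) \<le> ?g k x" using k by (auto intro: ennreal_leI)
        also have "\<dots> \<le> (\<Sum>k. ?g k x)"
        proof -
          define G where "G = (\<lambda>k. ?g k x)"
          have "G k \<le> suminf G" using sum_le_suminf[of G "{k}"] by simp
          then show ?thesis by (simp only: G_def)
        qed
        finally show ?thesis using x False by simp
      qed
    qed simp
  qed
  also have "\<dots> = (\<integral>\<^sup>+ x. ennreal C * indicator {0..D} x \<partial>lborel) + (\<Sum>k. \<integral>\<^sup>+ x. ?g k x \<partial>lborel)"
    by (subst nn_integral_add) (auto simp: nn_integral_suminf)
  also have "\<dots> = ennreal C * emeasure lborel {0..D} + ennreal (\<Sum>k. b k / a k)"
  proof -
    have "(\<Sum>k. ennreal (b k / a k)) = ennreal (\<Sum>k. b k / a k)"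
      using a b by (intro suminf_ennreal2 sum divide_nonneg_pos)
    moreover have "(\<integral>\<^sup>+ x. ennreal C * indicator {0..D} x \<partial>lborel) = ennreal C * emeasure lborel {0..D}"
      by (rule nn_integral_cmult_indicator) simp
    ultimately show ?thesis by (simp only: tail)
  qed
  also have "\<dots> < \<infinity>"
    by (simp add: emeasure_lborel_Icc_eq ennreal_mult_less_top)
  finally show ?thesis .
qed

text \<open>Levels run downwards, from fine accuracy \<open>a (m + d)\<close> to coarse
  \<open>a m\<close>. The induction peels off the finest level first, hence the generalised
  \<open>R\<close>.\<close>

lemma approx_on_interval_iterate:
  assumes step: "\<And>k R. m \<le> k \<Longrightarrow> approx_on_interval \<psi> \<Lambda> M (a (Suc k)) R \<Longrightarrow>
      approx_on_interval \<psi> \<Lambda> M (a k) (R + \<rho> k)"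
    and "approx_on_interval \<psi> \<Lambda> M (a (m + d)) R"
  shows "approx_on_interval \<psi> \<Lambda> M (a m) (R + (\<Sum>j<d. \<rho> (m + j)))"
  using assms(2)
proof (induction d arbitrary: R)
  case (Suc d)
  from Suc.prems have "approx_on_interval \<psi> \<Lambda> M (a (m + d)) (R + \<rho> (m + d))"
    by (intro step) auto
  from Suc.IH[OF this] show ?case by (simp add: algebra_simps)
qed simp

lemma nonintegrable_weight_unbounded:
  assumes \<psi>: "\<psi> \<in> {0..} \<rightarrow> {0..}"
    and int: "(\<integral>\<^sup>+ x\<in>{0..}. ennreal (\<psi> x / (1 + x\<^sup>2)) \<partial>lborel) = \<infinity>"
  shows "\<exists>x\<ge>0. C < \<psi> x"
proof (rule ccontr)
  assume "\<not> ?thesis"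
  then have C: "\<psi> x \<le> C" if "0 \<le> x" for x using that by force
  have "0 \<le> C" using C[of 0] \<psi> by (auto simp: Pi_iff intro: order_trans)
  have "(\<integral>\<^sup>+ x\<in>{0..}. ennreal (\<psi> x / (1 + x\<^sup>2)) \<partial>lborel) < \<infinity>"
  proof (rule nn_integral_weight_finite)
    \<comment> \<open>A bounded weight needs just one tail, \<open>C / x\<^sup>2\<close> on
      \<open>{1..}\<close>, so all other \<open>b k\<close> are 0.\<close>
    show "summable (\<lambda>k. (if k = 0 then C else 0) / 1 :: real)"
      by (rule summable_finite[of "{0}"]) auto
    show "\<exists>k. 1 \<le> x \<and> \<psi> x \<le> (if k = 0 then C else 0)" if "0 \<le> x" "1 < x" for x
      using that C by (intro exI[of _ 0]) auto
  qed (use C \<open>0 \<le> C\<close> in auto)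
  then show False using int by simp
qed

text \<open>If the partial sums stayed bounded, the steps would tend to 0, so the cap 1 would
  eventually be inactive and the sum of \<open>2 ^ k / r k\<close> would converge. Since \<psi>
  grows by the factor 2 from one \<open>r k\<close> to the next, this bounds its integral.\<close>

lemma dyadic_steps_unbounded:
  fixes r :: "nat \<Rightarrow> real"
  assumes \<psi>: "mono_on {0..} \<psi>" "\<psi> \<in> {0..} \<rightarrow> {0..}"
    and int: "(\<integral>\<^sup>+ x\<in>{0..}. ennreal (\<psi> x / (1 + x\<^sup>2)) \<partial>lborel) = \<infinity>"
    and A: "0 < A" and \<kappa>: "0 < \<kappa>"
    and r: "\<And>k. m \<le> k \<Longrightarrow> 0 < r k" "\<And>k. m \<le> k \<Longrightarrow> \<psi> (r k) = 2 ^ Suc k * A"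
  shows "\<exists>d. X \<le> (\<Sum>j<d. min 1 (\<kappa> * 2 ^ (m + j) / r (m + j)))"
proof (rule ccontr)
  let ?\<rho> = "\<lambda>j. min 1 (\<kappa> * 2 ^ (m + j) / r (m + j))"
  assume "\<not> ?thesis"
  then have bd: "(\<Sum>j<d. ?\<rho> j) \<le> X" for d by (meson linear)
  have \<rho>0: "0 \<le> ?\<rho> j" for j using r(1)[of "m + j"] \<kappa> by simp
  have sum: "summable ?\<rho>"
    by (rule bounded_imp_summable[of _ X])
       (use \<rho>0 bd[of "Suc _"] in \<open>simp_all add: lessThan_Suc_atMost\<close>)
  then have "?\<rho> \<longlonglongrightarrow> 0" by (rule summable_LIMSEQ_zero)
  then have "\<forall>\<^sub>F j in sequentially. ?\<rho> j < 1" by (rule order_tendstoD) simp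
  then have "\<forall>\<^sub>F j in sequentially. ?\<rho> j = \<kappa> * 2 ^ (m + j) / r (m + j)"
    by eventually_elim (auto simp: min_def split: if_splits)
  from summable_cong[OF this] sum have "summable (\<lambda>j. \<kappa> * 2 ^ (m + j) / r (m + j))" by simp
  \<comment> \<open>The factor makes the terms equal to \<open>\<psi> (r (Suc k)) / r k\<close> for
    \<open>k = m + j\<close>: on the stretch from \<open>r k\<close> to \<open>r (Suc k)\<close>,
    \<psi> is at most its value at the right end.\<close>
  from summable_mult[OF this, of "4 * A / \<kappa>"]
  have sum': "summable (\<lambda>j. 2 ^ Suc (Suc (m + j)) * A / r (m + j))"
    using \<kappa> by (simp add: field_simps)
  have "(\<integral>\<^sup>+ x\<in>{0..}. ennreal (\<psi> x / (1 + x\<^sup>2)) \<partial>lborel) < \<infinity>"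
  proof (rule nn_integral_weight_finite[OF _ _ _ sum'])
    have rm: "0 < r m" by (rule r) simp
    then show "0 \<le> \<psi> (r m)" using \<psi>(2) by (auto simp: Pi_iff)
    show "\<psi> x \<le> \<psi> (r m)" if "0 \<le> x" "x \<le> r m" for x
      using that \<psi>(1) by (auto simp: mono_on_def)
    show "0 < r (m + j)" for j by (rule r) simp
    show "0 \<le> 2 ^ Suc (Suc (m + j)) * A" for j using A by simp
    fix x assume x: "0 \<le> x" "r m < x"
    have "\<exists>j. \<psi> x / A < 2 ^ j" by (rule real_arch_pow) simp
    then obtain j0 where "\<psi> x / A < 2 ^ j0" by blast
    also have "(2::real) ^ j0 \<le> 2 ^ Suc (Suc (m + j0))" by (intro power_increasing) auto
    finally have ex: "\<psi> x \<le> 2 ^ Suc (Suc (m + j0)) * A" using A by (simp add: field_simps)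
    \<comment> \<open>Minimality gives \<open>\<psi> x > \<psi> (r (m + j))\<close> unless
      \<open>j = 0\<close>, and monotonicity turns this into \<open>r (m + j) \<le> x\<close>. For
      \<open>j = 0\<close> the latter is the assumption on \<open>x\<close>.\<close>
    define j where "j = (LEAST j. \<psi> x \<le> 2 ^ Suc (Suc (m + j)) * A)"
    have j: "\<psi> x \<le> 2 ^ Suc (Suc (m + j)) * A" unfolding j_def by (rule LeastI[of _ j0]) (rule ex)
    have "r (m + j) \<le> x"
    proof (cases j)
      case (Suc i)
      then have "i < j" by simp
      then have "\<not> \<psi> x \<le> 2 ^ Suc (Suc (m + i)) * A" unfolding j_def by (rule not_less_Least)
      then have "\<not> \<psi> x \<le> \<psi> (r (m + j))" using r(2)[of "m + j"] Suc by simp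
      moreover have "0 \<le> r (m + j)" using r(1)[of "m + j"] by simp
      ultimately show ?thesis using \<psi>(1) x unfolding mono_on_def by (metis atLeast_iff linear)
    qed (use x in simp)
    with j show "\<exists>j. r (m + j) \<le> x \<and> \<psi> x \<le> 2 ^ Suc (Suc (m + j)) * A" by blast
  qed
  then show False using int by simp
qed

section \<open>Every single frequency is approximable\<close>

lemma weighted_approx_expo_full_line:
  assumes \<psi>: "\<psi> \<in> {0..} \<rightarrow> {0..}" "continuous_on {0..} \<psi>" "mono_on {0..} \<psi>"
    and int: "(\<integral>\<^sup>+ x\<in>{0..}. ennreal (\<psi> x / (1 + x\<^sup>2)) \<partial>lborel) = \<infinity>"
    and \<Lambda>: "closed \<Lambda>" "emeasure lebesgue \<Lambda> > 0"
    and \<epsilon>: "0 < \<epsilon>"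
  shows "weighted_approx \<psi> \<Lambda> (expo l) \<epsilon>"
proof -
  have \<Lambda>_lm: "\<Lambda> \<inter> {-M..M} \<in> lmeasurable" for M
    using \<Lambda> by (intro lmeasurable_compact closed_Int_compact) auto
  \<comment> \<open>Were all bounded windows of \<Lambda> null, their countable union \<Lambda>
    would be null.\<close>
  obtain N :: nat where N: "0 < measure lebesgue (\<Lambda> \<inter> {- real N..real N})"
  proof (rule ccontr)
    assume *: "\<not> thesis"
    have "emeasure lebesgue (\<Lambda> \<inter> {- real N..real N}) = 0" for N
    proof -
      have "measure lebesgue (\<Lambda> \<inter> {- real N..real N}) = 0"
        using * that[of N] zero_less_measure_iff by blast
      then show ?thesis using \<Lambda>_lm[of "real N"] by (simp add: emeasure_eq_measure2)
    qed
    then have "emeasure lebesgue (\<Union>N. \<Lambda> \<inter> {- real N..real N}) = 0"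
      using \<Lambda>_lm by (intro emeasure_UN_eq_0) (auto intro: fmeasurableD)
    also have "(\<Union>N. \<Lambda> \<inter> {- real N..real N}) = \<Lambda>"
    proof -
      have "\<exists>N. x \<in> {- real N..real N}" for x
        using real_arch_simple[of "\<bar>x\<bar>"] by (auto simp: abs_le_iff minus_le_iff)
      then show ?thesis by auto
    qed
    finally show False using \<Lambda>(2) by simp
  qed
  define M where "M = real N"
  define E where "E = \<Lambda> \<inter> {-M..M}"
  have M: "0 \<le> M" by (simp add: M_def)
  have E: "E \<in> lmeasurable" "E \<subseteq> {-M..M}" "0 < measure lebesgue E"
    using N \<Lambda>_lm by (auto simp: E_def M_def)
  \<comment> \<open>The first bound is needed to enlarge intervals, the second is the density that
    \<open>exists_dense_cell\<close> can provide.\<close>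
  define \<eta> where "\<eta> = min (1 / 4) (measure lebesgue E / (2 * M + 1))"
  have \<eta>: "0 < \<eta>" "\<eta> \<le> 1 / 4" using E(3) M unfolding \<eta>_def by (simp, intro min.cobounded1)
  have \<eta>E: "\<eta> * (2 * M + 1) \<le> measure lebesgue E"
  proof -
    have "\<eta> \<le> measure lebesgue E / (2 * M + 1)" unfolding \<eta>_def by (rule min.cobounded2)
    then show ?thesis using M by (subst (asm) pos_le_divide_eq) auto
  qed
  have cell: "\<exists>u\<in>{-M..M}. \<eta> * \<rho> \<le> measure lebesgue (\<Lambda> \<inter> {u..u+\<rho>})" if \<rho>: "0 < \<rho>" "\<rho> \<le> 1" for \<rho>
  proof -
    obtain u where u: "u \<in> {-M..M}" "\<eta> * \<rho> \<le> measure lebesgue (E \<inter> {u..u+\<rho>})"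
      using exists_dense_cell[OF E(1,2) M \<rho> \<eta>(1) \<eta>E] by blast
    have "measure lebesgue (E \<inter> {u..u+\<rho>}) \<le> measure lebesgue (\<Lambda> \<inter> {u..u+\<rho>})"
      using \<Lambda>(1) E(1)
      by (intro measure_mono_fmeasurable lmeasurable_compact closed_Int_compact)
         (auto simp: E_def intro: fmeasurableD)
    then show ?thesis using u by force
  qed
  define q where "q = \<eta> / (12 * exp 1)"
  have q0: "0 < q" using \<eta> by (simp add: q_def)
  have "q \<le> 1 / (12 * 1)" unfolding q_def using \<eta> by (intro frac_le mult_left_mono) auto
  then have q1: "q < 1" by simp
  \<comment> \<open>With \<open>\<psi> (r k) = 2 ^ Suc k * A\<close> the weight at
    \<open>r k\<close> matches the accuracy:
    \<open>exp (- \<psi> (r k)) = q ^ (2 * 2 ^ k)\<close>.\<close>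
  define A where "A = - ln q"
  have A: "0 < A" using q0 q1 by (simp add: A_def)
  have expA: "exp (- (real n * A)) = q ^ n" for n
    using q0 by (simp add: A_def exp_of_nat_mult)
  \<comment> \<open>Makes \<open>\<rho> \<le> \<kappa> * 2 ^ k / r\<close> the Taylor condition
    \<open>2 * exp 1 * \<rho> * r \<le> q\<^sup>2 * 2 ^ k\<close>.\<close>
  define \<kappa> where "\<kappa> = q\<^sup>2 / (2 * exp 1)"
  have \<kappa>: "0 < \<kappa>" using q0 by (simp add: \<kappa>_def)

  \<comment> \<open>\<open>m1\<close> keeps the levels above \<open>\<psi> 0\<close>, so that the
    intermediate value theorem gives a positive \<open>r\<close>; \<open>m2\<close> brings the final
    accuracy \<open>q ^ (2 ^ m)\<close> below \<epsilon>.\<close>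
  obtain m1 where m1: "\<psi> 0 / A < 2 ^ m1" using real_arch_pow[of 2 "\<psi> 0 / A"] by auto
  obtain m2 where m2: "q ^ m2 < \<epsilon>" using real_arch_pow_inv[OF \<epsilon> q1] by blast
  define m where "m = m1 + m2"
  have "\<exists>r>0. \<psi> r = 2 ^ Suc k * A" if "m \<le> k" for k
  proof -
    have "\<psi> 0 / A < 2 ^ m1" by (rule m1)
    also have "\<dots> \<le> 2 ^ Suc k" using that by (intro power_increasing) (auto simp: m_def)
    finally have lower: "\<psi> 0 < 2 ^ Suc k * A" using A by (simp add: field_simps)
    obtain x where x: "0 \<le> x" "2 ^ Suc k * A < \<psi> x"
      using nonintegrable_weight_unbounded[OF \<psi>(1) int] by blast
    obtain r where "0 \<le> r" "r \<le> x" "\<psi> r = 2 ^ Suc k * A"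
      using IVT'[of \<psi> 0 "2 ^ Suc k * A" x] lower x continuous_on_subset[OF \<psi>(2)] by fastforce
    moreover have "r \<noteq> 0" using calculation lower by auto
    ultimately show ?thesis by (intro exI[of _ r]) auto
  qed
  then obtain r where r: "\<And>k. m \<le> k \<Longrightarrow> 0 < r k" "\<And>k. m \<le> k \<Longrightarrow> \<psi> (r k) = 2 ^ Suc k * A"
    by metis
  define \<rho> where "\<rho> k = min 1 (\<kappa> * 2 ^ k / r k)" for k
  have step: "approx_on_interval \<psi> \<Lambda> M (q ^ (2 ^ k)) (R + \<rho> k / 4)"
    if k: "m \<le> k" and R: "approx_on_interval \<psi> \<Lambda> M (q ^ (2 ^ Suc k)) R" for k R
  proof (rule approx_on_interval_enlarge[OF \<psi>(3,1) \<Lambda>(1) _ \<eta> q_def])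
    show "1 \<le> (2 :: nat) ^ k" by simp
    show \<rho>: "0 < \<rho> k" "\<rho> k \<le> 1" using \<kappa> r(1)[OF k] by (auto simp: \<rho>_def)
    show "0 < r k" by (rule r(1)[OF k])
    show "exp (- \<psi> (r k)) \<le> q ^ (2 * 2 ^ k)"
      using expA[of "2 ^ Suc k"] by (simp add: r(2)[OF k])
    have "\<rho> k * r k \<le> \<kappa> * 2 ^ k / r k * r k"
      using r(1)[OF k] by (intro mult_right_mono) (auto simp: \<rho>_def)
    then have "\<rho> k * r k \<le> \<kappa> * 2 ^ k" using r(1)[OF k] by simp
    then show "2 * exp 1 * \<rho> k * r k \<le> q\<^sup>2 * real (2 ^ k)"
      by (simp add: \<kappa>_def field_simps)
    show "\<exists>u\<in>{-M..M}. \<eta> * \<rho> k \<le> measure lebesgue (\<Lambda> \<inter> {u..u + \<rho> k})"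
      by (rule cell[OF \<rho>])
    show "approx_on_interval \<psi> \<Lambda> M (q ^ (2 * 2 ^ k)) R" using R by simp
  qed
  \<comment> \<open>Each step adds \<open>\<rho> k / 4\<close> to the radius, and the final centre
    is at distance at most \<open>\<bar>l\<bar> + M + 1\<close> from \<open>l\<close>.\<close>
  obtain d where d: "4 * (\<bar>l\<bar> + M + 1) \<le> (\<Sum>j<d. \<rho> (m + j))"
    unfolding \<rho>_def using dyadic_steps_unbounded[OF \<psi>(3,1) int A \<kappa> r] by blast
  have "E \<noteq> {}" using E(3) by auto
  then obtain c where c: "c \<in> E" by blast
  \<comment> \<open>The start is a single point of \<Lambda>: its exponential is in the span, so any
    accuracy is available, however large \<open>d\<close> is.\<close>
  have "approx_on_interval \<psi> \<Lambda> M (q ^ (2 ^ (m + d))) 0"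
    unfolding approx_on_interval_def
  proof (intro exI[of _ c] conjI allI impI)
    show "\<bar>c\<bar> \<le> M + 1" using c by (auto simp: E_def)
    show "weighted_approx \<psi> \<Lambda> (expo l) (q ^ (2 ^ (m + d)))" if "\<bar>l - c\<bar> \<le> 0" for l
      using that c q0
      by (intro weighted_approx_mono[OF weighted_approx_exp_span] exp_span_expo) (auto simp: E_def)
  qed
  from approx_on_interval_iterate[where a = "\<lambda>k. q ^ (2 ^ k)" and \<rho> = "\<lambda>k. \<rho> k / 4", OF step this]
  have "approx_on_interval \<psi> \<Lambda> M (q ^ (2 ^ m)) (\<Sum>j<d. \<rho> (m + j) / 4)" by simp
  then obtain c' where c': "\<bar>c'\<bar> \<le> M + 1"
    "\<And>l. \<bar>l - c'\<bar> \<le> (\<Sum>j<d. \<rho> (m + j) / 4) \<Longrightarrow> weighted_approx \<psi> \<Lambda> (expo l) (q ^ (2 ^ m))"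
    unfolding approx_on_interval_def by blast
  have "\<bar>l - c'\<bar> \<le> \<bar>l\<bar> + M + 1" using c'(1) by linarith
  also have "\<dots> \<le> (\<Sum>j<d. \<rho> (m + j)) / 4" using d by simp
  also have "\<dots> = (\<Sum>j<d. \<rho> (m + j) / 4)" by (rule sum_divide_distrib)
  finally have "weighted_approx \<psi> \<Lambda> (expo l) (q ^ (2 ^ m))" by (rule c'(2))
  moreover have "q ^ (2 ^ m) \<le> q ^ m2"
  proof (rule power_decreasing)
    have "m2 \<le> m" by (simp add: m_def)
    also have "m \<le> 2 ^ m" by (rule less_imp_le[OF less_exp])
    finally show "m2 \<le> 2 ^ m" .
  qed (use q0 q1 in auto)
  ultimately show ?thesis using m2 by (elim weighted_approx_mono) linarith
qed

subsection \<open>Trigonometric approximation\<close>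

text \<open>Frequencies add under multiplication, so with all frequencies allowed the span is an
  algebra.\<close>

lemma exp_span_mult:
  assumes "f \<in> exp_span UNIV" "g \<in> exp_span UNIV"
  shows "(\<lambda>x. f x * g x) \<in> exp_span UNIV"
proof -
  have expo_g: "(\<lambda>x. expo l x * g x) \<in> exp_span UNIV" for l
    using assms(2)
  proof (induction rule: exp_span_induct)
    case zero
    then show ?case by (simp add: exp_span_zero)
  next
    case (step c k g)
    have "(\<lambda>x. c * expo (l + k) x + expo l x * g x) \<in> exp_span UNIV"
      by (intro exp_span_add exp_span_scale exp_span_expo step UNIV_I)
    then show ?case by (simp add: expo_mult[symmetric] algebra_simps)
  qed
  show ?thesis
    using assms(1)
  proof (induction rule: exp_span_induct)
    case zero
    then show ?case by (simp add: exp_span_zero)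
  next
    case (step c l f)
    have "(\<lambda>x. c * (expo l x * g x) + f x * g x) \<in> exp_span UNIV"
      by (intro exp_span_add exp_span_scale expo_g step)
    then show ?case by (simp add: algebra_simps)
  qed
qed

lemma real_polynomial_cis_in_exp_span:
  assumes "real_polynomial_function (p :: complex \<Rightarrow> real)"
  shows "(\<lambda>x. of_real (p (cis (s * x)))) \<in> exp_span UNIV"
  using assms
proof induction
  case (linear f)
  then interpret f: bounded_linear f .
  \<comment> \<open>Euler's formulas for cosine and sine; by the sign convention
    \<open>expo (- s) x\<close> is \<open>cis (s * x)\<close>.\<close>
  have "complex_of_real (f (cis (s * x))) =
      (f 1 - \<i> * f \<i>) / 2 * expo (- s) x + (f 1 + \<i> * f \<i>) / 2 * expo s x" for x
  proof -
    have "cis (s * x) = cos (s * x) *\<^sub>R 1 + sin (s * x) *\<^sub>R \<i>" by (simp add: complex_eq_iff)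
    then have "f (cis (s * x)) = cos (s * x) * f 1 + sin (s * x) * f \<i>"
      by (simp only: f.add f.scaleR real_scaleR_def)
    moreover have "expo (- s) x = cis (s * x)" "expo s x = cis (- (s * x))"
      by (simp_all add: expo_def cis_conv_exp mult_ac)
    ultimately show ?thesis by (simp add: complex_eq_iff field_simps)
  qed
  then show ?case by (simp only: exp_span_add exp_span_scale exp_span_expo UNIV_I)
next
  case (const c)
  have "(\<lambda>x. c * expo 0 x) \<in> exp_span UNIV" by (intro exp_span_scale exp_span_expo UNIV_I)
  then show ?case by (simp add: expo_def)
qed (simp_all add: exp_span_add exp_span_mult)

text \<open>Wrap \<open>g\<close> around the unit circle with period \<open>2 * T\<close> and
  approximate there by Stone-Weierstrass. The second bound holds on the whole line because
  \<open>p\<close> is periodic; it controls \<open>p\<close> outside \<open>{-T..T}\<close>.\<close>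

lemma uniform_trig_approx:
  fixes g :: "real \<Rightarrow> complex"
  assumes g: "continuous_on UNIV g" "\<And>x. S \<le> \<bar>x\<bar> \<Longrightarrow> g x = 0" and ST: "0 \<le> S" "S < T" and \<epsilon>: "0 < \<epsilon>"
  shows "\<exists>p\<in>exp_span UNIV. (\<forall>x. \<bar>x\<bar> \<le> T \<longrightarrow> cmod (g x - p x) < \<epsilon>) \<and>
    (\<forall>x. \<exists>y. cmod (p x) \<le> cmod (g y) + \<epsilon>)"
proof -
  define h where "h z = g (T * Arg z / pi)" for z
  have T: "0 < T" using ST by simp
  have "isCont h z" if z: "cmod z = 1" for z
  proof (cases "z \<in> \<real>\<^sub>\<le>\<^sub>0")
    case False
    have "isCont (\<lambda>z. T * Arg z / pi) z"
      using continuous_at_Arg[OF False] by (intro continuous_intros) auto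
    moreover have "isCont g (T * Arg z / pi)" using g(1) by (simp add: continuous_on_eq_continuous_at)
    ultimately show ?thesis unfolding h_def by (rule isCont_o2)
  next
    case True
    with z have z1: "z = -1" by (auto simp: complex_nonpos_Reals_iff complex_eq_iff cmod_def power2_eq_1_iff)
    \<comment> \<open>The angle that corresponds to \<open>S\<close>. \<open>Arg\<close> jumps at
      -1, but \<open>h\<close> vanishes on the open sector where |Arg| exceeds \<alpha>, which is
      described by real part and modulus only.\<close>
    define \<alpha> where "\<alpha> = pi * S / T"
    have \<alpha>: "0 \<le> \<alpha>" "\<alpha> < pi" using ST T by (auto simp: \<alpha>_def field_simps)
    have "cos pi < cos \<alpha>" using \<alpha> by (intro cos_monotone_0_pi) auto
    then have "Re z < 0 + cos \<alpha> * cmod z" by (simp add: z1)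
    moreover have "open {w. Re w < 0 + cos \<alpha> * cmod w}"
      by (intro open_Collect_less continuous_intros)
    ultimately have "\<forall>\<^sub>F w in nhds z. w \<in> {w. Re w < 0 + cos \<alpha> * cmod w}"
      by (intro eventually_nhds_in_open) auto
    then have "\<forall>\<^sub>F w in nhds z. h w = 0"
    proof eventually_elim
      case (elim w)
      have "w \<noteq> 0" using elim by auto
      have "cmod w * cos (Arg w) < cmod w * cos \<alpha>"
        using elim rcis_cmod_Arg[of w] by (metis Re_rcis add_0 mem_Collect_eq mult.commute)
      then have "cos \<bar>Arg w\<bar> < cos \<alpha>" using \<open>w \<noteq> 0\<close> by simp
      then have "\<alpha> \<le> \<bar>Arg w\<bar>"
        using cos_monotone_0_pi_le[of "\<bar>Arg w\<bar>" \<alpha>] \<alpha> by (meson abs_ge_zero leD linear less_imp_le)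
      then have "S \<le> \<bar>T * Arg w / pi\<bar>" using T by (simp add: \<alpha>_def abs_mult field_simps)
      then show ?case using g(2) by (simp add: h_def)
    qed
    moreover from this have "h z = 0" by (rule eventually_nhds_x_imp_x)
    ultimately show ?thesis
      by (subst isCont_cong[of h "\<lambda>_. 0"]) auto
  qed
  then have "continuous_on (sphere 0 1) h"
    by (intro continuous_at_imp_continuous_on) auto
  from Stone_Weierstrass_polynomial_function[OF compact_sphere this \<epsilon>]
  obtain P where P: "polynomial_function P" "\<And>z. cmod z = 1 \<Longrightarrow> cmod (h z - P z) < \<epsilon>" by auto
  define p where "p x = P (cis (pi / T * x))" for x
  show ?thesis
  proof (intro bexI[of _ p] conjI allI impI)
    have "real_polynomial_function (\<lambda>z. Re (P z))" "real_polynomial_function (\<lambda>z. Im (P z))"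
      using P(1) bounded_linear_Re bounded_linear_Im by (auto simp: polynomial_function_def o_def)
    then have "(\<lambda>x. of_real (Re (p x)) + \<i> * of_real (Im (p x))) \<in> exp_span UNIV"
      unfolding p_def by (intro exp_span_add exp_span_scale real_polynomial_cis_in_exp_span)
    then show "p \<in> exp_span UNIV" by (simp add: complex_eq[symmetric])
    show "cmod (g x - p x) < \<epsilon>" if x: "\<bar>x\<bar> \<le> T" for x
    proof -
      have "h (cis (pi / T * x)) = g x"
      proof (cases "x = - T")
        \<comment> \<open>The argument of -1 is pi, so \<open>h\<close> reads off \<open>g T\<close>
          instead of \<open>g (- T)\<close>; both are 0.\<close>
        case True
        then have "cis (pi / T * x) = of_real (-1)" using T by (simp add: complex_eq_iff)
        then have "h (cis (pi / T * x)) = g T" by (simp add: h_def Arg_of_real del: of_real_minus)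
        then show ?thesis using g(2)[of T] g(2)[of x] ST True by simp
      next
        case False
        then have "pi / T * (- T) < pi / T * x" "pi / T * x \<le> pi / T * T"
          using x T False
          by (intro mult_strict_left_mono mult_left_mono; auto)+
        then have "Arg (cis (pi / T * x)) = pi / T * x" using T by (intro Arg_cis) auto
        then show ?thesis using T by (simp add: h_def)
      qed
      then show ?thesis using P(2)[of "cis (pi / T * x)"] by (simp add: p_def)
    qed
    show "\<exists>y. cmod (p x) \<le> cmod (g y) + \<epsilon>" for x
    proof -
      have "cmod (p x) \<le> cmod (h (cis (pi / T * x))) + cmod (h (cis (pi / T * x)) - p x)"
        by (metis norm_triangle_sub norm_minus_commute)
      also have "\<dots> \<le> cmod (h (cis (pi / T * x))) + \<epsilon>"
        using P(2)[of "cis (pi / T * x)"] by (simp add: p_def)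
      finally show ?thesis unfolding h_def by (rule exI)
    qed
  qed
qed

text \<open>First cut \<open>f\<close> off, which costs little because \<open>f\<close> is small
  relative to the weight far out; then approximate the cut-off function uniformly on a long
  interval. Outside it the periodic approximant stays bounded while the weight is large.\<close>

lemma weighted_approx_trig:
  assumes \<psi>: "\<psi> \<in> {0..} \<rightarrow> {0..}" "mono_on {0..} \<psi>" and unbounded: "\<And>C. \<exists>x\<ge>0. C < \<psi> x"
    and f: "f \<in> C_weighted \<psi>" and \<epsilon>: "0 < \<epsilon>"
  shows "weighted_approx \<psi> UNIV f \<epsilon>"
proof -
  have fc: "continuous_on UNIV f" using f by (simp add: C_weighted_def)
  have "((\<lambda>x. f x / complex_of_real (exp (\<psi> \<bar>x\<bar>))) \<longlongrightarrow> 0) at_infinity"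
    using f by (simp add: C_weighted_def)
  from tendstoD[OF this, of "\<epsilon> / 2"] \<epsilon>
  have "\<forall>\<^sub>F x in at_infinity. cmod (f x) < \<epsilon> / 2 * exp (\<psi> \<bar>x\<bar>)"
    by (simp add: norm_divide field_simps)
  then obtain R0 where R0: "\<And>x. R0 \<le> \<bar>x\<bar> \<Longrightarrow> cmod (f x) < \<epsilon> / 2 * exp (\<psi> \<bar>x\<bar>)"
    by (auto simp: eventually_at_infinity)
  define R where "R = max 0 R0"
  \<comment> \<open>A continuous cutoff: 1 on \<open>{-R..R}\<close>, 0 beyond distance
    \<open>R + 1\<close>, linear in between.\<close>
  define w where "w x = max 0 (min 1 (R + 1 - \<bar>x\<bar>))" for x
  define g where "g x = of_real (w x) * f x" for x
  have w: "0 \<le> w x" "w x \<le> 1" for x by (auto simp: w_def)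
  have gc: "continuous_on UNIV g" unfolding g_def w_def by (intro continuous_intros fc)
  have g0: "g x = 0" if "R + 1 \<le> \<bar>x\<bar>" for x using that by (simp add: g_def w_def)
  have fg: "cmod (f x - g x) \<le> \<epsilon> / 2 * exp (\<psi> \<bar>x\<bar>)" for x
  proof (cases "\<bar>x\<bar> \<le> R")
    case True
    then have "g x = f x" by (simp add: g_def w_def)
    then show ?thesis using \<epsilon> by simp
  next
    case False
    have "f x - g x = of_real (1 - w x) * f x" by (simp add: g_def algebra_simps)
    then have "cmod (f x - g x) = (1 - w x) * cmod (f x)" using w(2)[of x]
      by (simp only: norm_mult norm_of_real abs_of_nonneg diff_ge_0_iff_ge)
    also have "\<dots> \<le> 1 * cmod (f x)" using w by (intro mult_right_mono) auto
    also have "\<dots> \<le> \<epsilon> / 2 * exp (\<psi> \<bar>x\<bar>)" using R0[of x] False unfolding R_def by linarith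
    finally show ?thesis .
  qed
  have "compact (g ` {-(R+1)..R+1})"
    by (intro compact_continuous_image continuous_on_subset[OF gc]) auto
  then obtain G0 where G0: "\<And>x. x \<in> {-(R+1)..R+1} \<Longrightarrow> cmod (g x) \<le> G0"
    by (force dest!: compact_imp_bounded simp: bounded_iff)
  define G where "G = max 0 G0"
  have G: "cmod (g x) \<le> G" for x
  proof (cases "\<bar>x\<bar> \<le> R + 1")
    case True
    then show ?thesis using G0[of x] by (simp add: G_def abs_le_iff minus_le_iff)
  qed (simp add: g0 G_def)
  \<comment> \<open>Beyond \<open>X\<close> the weighted tolerance exceeds \<open>G + 1\<close>, a
    bound for the approximant since \<open>\<delta> \<le> 1\<close>.\<close>
  obtain X where X: "0 \<le> X" "(G + 1) / (\<epsilon> / 2) < \<psi> X" using unbounded by blast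
  define T where "T = max X (R + 2)"
  define \<delta> where "\<delta> = min (\<epsilon> / 2) 1"
  have "0 \<le> R + 1" "R + 1 < T" "0 < \<delta>" using \<epsilon> by (auto simp: R_def T_def \<delta>_def)
  from uniform_trig_approx[OF gc g0 this] obtain p where p: "p \<in> exp_span UNIV"
    "\<And>x. \<bar>x\<bar> \<le> T \<Longrightarrow> cmod (g x - p x) < \<delta>" "\<And>x. \<exists>y. cmod (p x) \<le> cmod (g y) + \<delta>" by blast
  have gp: "cmod (g x - p x) \<le> \<epsilon> / 2 * exp (\<psi> \<bar>x\<bar>)" for x
  proof (cases "\<bar>x\<bar> \<le> T")
    case True
    then have "cmod (g x - p x) \<le> \<epsilon> / 2 * 1" using p(2)[of x] by (simp add: \<delta>_def)
    also have "\<dots> \<le> \<epsilon> / 2 * exp (\<psi> \<bar>x\<bar>)"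
      using \<epsilon> \<psi>(1) by (intro mult_left_mono) (auto simp: Pi_iff)
    finally show ?thesis .
  next
    case False
    then have "g x = 0" by (intro g0) (simp add: T_def)
    moreover obtain y where "cmod (p x) \<le> cmod (g y) + \<delta>" using p(3) by blast
    ultimately have "cmod (g x - p x) \<le> G + 1" using G[of y] by (simp add: \<delta>_def)
    also have "\<dots> \<le> \<epsilon> / 2 * \<psi> X" using X \<epsilon> by (simp add: field_simps)
    also have "\<dots> \<le> \<epsilon> / 2 * exp (\<psi> \<bar>x\<bar>)"
    proof (intro mult_left_mono)
      have "\<psi> X \<le> \<psi> \<bar>x\<bar>" using \<psi>(2) X False by (auto simp: mono_on_def T_def)
      also have "\<dots> \<le> exp (\<psi> \<bar>x\<bar>)" using exp_ge_add_one_self[of "\<psi> \<bar>x\<bar>"] by linarith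
      finally show "\<psi> X \<le> exp (\<psi> \<bar>x\<bar>)" .
    qed (use \<epsilon> in simp)
    finally show ?thesis .
  qed
  have "cmod (f x - p x) \<le> \<epsilon> * exp (\<psi> \<bar>x\<bar>)" for x
    using norm_triangle_mono[OF fg[of x] gp[of x]] by (simp add: algebra_simps)
  then show ?thesis unfolding weighted_approx_def using p(1) by (intro bexI) auto
qed

section \<open>Density in the weighted space\<close>

text \<open>Exponentials have modulus 1, so all that matters is that the monotone, unbounded \<psi>
  tends to infinity.\<close>

lemma exp_span_subset_C_weighted:
  assumes \<psi>: "mono_on {0..} \<psi>" and unbounded: "\<And>C. \<exists>x\<ge>0. C < \<psi> x"
  shows "exp_span \<Lambda> \<subseteq> C_weighted \<psi>"
proof
  have lim: "((\<lambda>x. expo l x / complex_of_real (exp (\<psi> \<bar>x\<bar>))) \<longlongrightarrow> 0) at_infinity" for l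
  proof (rule tendstoI)
    fix e :: real assume e: "0 < e"
    obtain X where X: "0 \<le> X" "1 / e < \<psi> X" using unbounded by blast
    have "dist (expo l x / complex_of_real (exp (\<psi> \<bar>x\<bar>))) 0 < e" if "X \<le> \<bar>x\<bar>" for x
    proof -
      have "1 / e < \<psi> \<bar>x\<bar>" using X that \<psi> by (force simp: mono_on_def intro: less_le_trans)
      also have "\<dots> < exp (\<psi> \<bar>x\<bar>)" using exp_ge_add_one_self[of "\<psi> \<bar>x\<bar>"] by linarith
      finally show ?thesis using e by (simp add: norm_divide field_simps)
    qed
    then show "\<forall>\<^sub>F x in at_infinity. dist (expo l x / complex_of_real (exp (\<psi> \<bar>x\<bar>))) 0 < e"
      unfolding eventually_at_infinity by auto
  qed
  fix f assume "f \<in> exp_span \<Lambda>"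
  then show "f \<in> C_weighted \<psi>"
  proof (induction rule: exp_span_induct)
    case zero
    then show ?case by (simp add: C_weighted_def)
  next
    case (step c l g)
    have "((\<lambda>x. c * (expo l x / complex_of_real (exp (\<psi> \<bar>x\<bar>))) + g x / complex_of_real (exp (\<psi> \<bar>x\<bar>)))
        \<longlongrightarrow> c * 0 + 0) at_infinity"
      using step by (intro tendsto_intros lim) (simp add: C_weighted_def)
    moreover have "continuous_on UNIV (\<lambda>x. c * expo l x + g x)"
      using step unfolding expo_def by (intro continuous_intros) (simp add: C_weighted_def)
    ultimately show ?case by (simp add: C_weighted_def add_divide_distrib)
  qed
qed

theorem theorem2p1:
  fixes \<psi> :: "real \<Rightarrow> real" and \<Lambda> :: "real set"
  assumes "\<psi> \<in> {0..} \<rightarrow> {0..}"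
    and "continuous_on {0..} \<psi>"
    and "mono_on {0..} \<psi>"
    and "(\<integral>\<^sup>+ x\<in>{0..}. ennreal (\<psi> x / (1 + x\<^sup>2)) \<partial>lborel) = \<infinity>"
    and "closed \<Lambda>"
    and "emeasure lebesgue \<Lambda> > 0"
  shows "exp_span \<Lambda> \<subseteq> C_weighted \<psi> \<and>
    C_weighted_topology \<psi> closure_of exp_span \<Lambda> = C_weighted \<psi>"
proof -
  note unbounded = nonintegrable_weight_unbounded[OF assms(1,4)]
  have sub: "exp_span \<Lambda> \<subseteq> C_weighted \<psi>"
    by (rule exp_span_subset_C_weighted[OF assms(3) unbounded])
  have trig: "weighted_approx \<psi> \<Lambda> p \<epsilon>" if "p \<in> exp_span UNIV" "0 < \<epsilon>" for p \<epsilon>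
    using that
  proof (induction arbitrary: \<epsilon> rule: exp_span_induct)
    case zero
    then show ?case
      using weighted_approx_mono[OF weighted_approx_exp_span[OF exp_span_zero]] by simp
  next
    case (step c l g)
    \<comment> \<open>Half of the error goes to the new term and half to \<open>g\<close>; the added
      1 covers \<open>c = 0\<close>.\<close>
    define \<delta> where "\<delta> = \<epsilon> / 2 / (cmod c + 1)"
    have \<delta>: "0 < \<delta>" using step.prems by (simp add: \<delta>_def add_nonneg_pos)
    have "K * (\<epsilon> / 2 / K) = \<epsilon> / 2" if "0 < K" for K :: real using that by simp
    then have "(cmod c + 1) * \<delta> = \<epsilon> / 2" unfolding \<delta>_def by (simp only: add_nonneg_pos norm_ge_zero zero_less_one)
    then have "cmod c * \<delta> + \<epsilon> / 2 \<le> \<epsilon>" using \<delta> by (simp add: algebra_simps)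
    moreover have "weighted_approx \<psi> \<Lambda> (\<lambda>x. c * expo l x + g x) (cmod c * \<delta> + \<epsilon> / 2)"
      using step.prems
      by (intro weighted_approx_add weighted_approx_scale weighted_approx_expo_full_line[OF assms \<delta>] step.IH) auto
    ultimately show ?case by (rule weighted_approx_mono[rotated])
  qed
  have "\<exists>g\<in>exp_span \<Lambda>. weighted_norm \<psi> (f - g) < \<epsilon>" if f: "f \<in> C_weighted \<psi>" and \<epsilon>: "0 < \<epsilon>" for f \<epsilon>
  proof -
    \<comment> \<open>Two errors of \<epsilon>/4 give \<epsilon>/2, because the supremum preserves
      only non-strict bounds.\<close>
    have "weighted_approx \<psi> UNIV f (\<epsilon> / 4)"
      using weighted_approx_trig[OF assms(1,3) unbounded f] \<epsilon> by simp
    then obtain p where p: "p \<in> exp_span UNIV" "\<And>x. cmod (f x - p x) \<le> \<epsilon> / 4 * exp (\<psi> \<bar>x\<bar>)"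
      by (auto simp: weighted_approx_def)
    have "weighted_approx \<psi> \<Lambda> f (\<epsilon> / 4 + \<epsilon> / 4)"
      using \<epsilon> by (intro weighted_approx_perturb[OF trig[OF p(1)] p(2)]) simp
    then obtain g where g: "g \<in> exp_span \<Lambda>" "\<And>x. cmod (f x - g x) \<le> \<epsilon> / 2 * exp (\<psi> \<bar>x\<bar>)"
      by (auto simp: weighted_approx_def)
    have "weighted_norm \<psi> (f - g) \<le> \<epsilon> / 2"
      unfolding weighted_norm_def using g(2) by (intro cSUP_least) (auto simp: pos_divide_le_eq)
    then show ?thesis using g(1) \<epsilon> by (intro bexI[of _ g]) auto
  qed
  then show ?thesis using sub C_weighted_dense_iff[OF assms(1) sub] by blast
qed

end
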